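(* Let $G$ be a (discrete) group. Any isomorphism $\Phi:X\to Y$ of spaces induces an isomorphism $$\int_{\Phi^*P}A\cong\int_PA$$ for any $G$-bundle $P$ over $Y$ and any $G$-equivariant $E_\infty$-algebra $A$ over a field $k$.
   Context: $E_\infty\text{-}\mathbf{Alg}$ is the category of $E_\infty$-algebras in differential graded vector spaces over $k$, with the model structure induced from the projective model structure on differential graded vector spaces and with its tensoring $\otimes$ over the category $\mathbf{sSet}$ of simplicial sets. A $G$-equivariant $E_\infty$-algebra is a functor $\star/\!/G\to E_\infty\text{-}\mathbf{Alg}$ from the groupoid with one object and automorphism group $G$, i.e. an $E_\infty$-algebra with $G$-action. For a principal $G$-bundle $P$ over a space (or simplicial set), with its right $G$-action on the total space, the equivariant higher Hochschild chains are $$\int_PA:=P\overset{\mathbb L}{\otimes}_GA\in E_\infty\text{-}\mathbf{Alg},$$ modelled by the geometric realization of the simplicial $E_\infty$-algebra (bar construction) $B_m(P,\star/\!/G,QA)=(P\times G^m)\otimes QA$. Here $QA$ is a (functorial) cofibrant replacement of $A$ as an $E_\infty$-algebra, so that $G$ acts on $QA$. For topological spaces one first passes to singular simplicial sets. If $P=\varphi^*EG$ for a map $\varphi$ to $BG$, where $EG\to BG$ is the universal $G$-bundle, one also writes $\int_\varphi A:=\int_PA$. *)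

theory Defs
  imports "HOL-Algebra.Module" "HOL-Homology.Simplices" "HOL-Combinatorics.Permutations"
begin

section \<open>Differential graded vector spaces\<close>

text \<open>A dg vector space is a module over the field \<open>k\<close> which is the direct sum of its homogeneous
  parts \<open>hdeg V n\<close>, \<open>n \<in> \<int>\<close>, with a differential of degree \<open>-1\<close>. The fields \<open>mult\<close> and \<open>one\<close>
  inherited from the module record carry no meaning.\<close>

record ('k, 'v) dg = "('k, 'v) module" +
  hdeg :: "int \<Rightarrow> 'v set"
  dif :: "'v \<Rightarrow> 'v"

definition linear_map ::
  "'k ring \<Rightarrow> ('k, 'v, 'x) module_scheme \<Rightarrow> ('k, 'w, 'y) module_scheme \<Rightarrow> ('v \<Rightarrow> 'w) \<Rightarrow> bool" where
  "linear_map k V W f \<longleftrightarrow>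
     f \<in> carrier V \<rightarrow> carrier W \<and>
     (\<forall>x\<in>carrier V. \<forall>y\<in>carrier V. f (x \<oplus>\<^bsub>V\<^esub> y) = f x \<oplus>\<^bsub>W\<^esub> f y) \<and>
     (\<forall>a\<in>carrier k. \<forall>x\<in>carrier V. f (a \<odot>\<^bsub>V\<^esub> x) = a \<odot>\<^bsub>W\<^esub> f x)"

definition dg_space :: "'k ring \<Rightarrow> ('k, 'v, 'x) dg_scheme \<Rightarrow> bool" where
  "dg_space k V \<longleftrightarrow>
     Module.module k V \<and>
     (\<forall>n. submodule (hdeg V n) k V) \<and>
     (\<forall>v\<in>carrier V. \<exists>!c. (\<forall>n. c n \<in> hdeg V n) \<and> finite {n. c n \<noteq> \<zero>\<^bsub>V\<^esub>} \<and>
        v = (\<Oplus>\<^bsub>V\<^esub>n\<in>{n. c n \<noteq> \<zero>\<^bsub>V\<^esub>}. c n)) \<and>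
     linear_map k V V (dif V) \<and>
     (\<forall>n. dif V ` hdeg V n \<subseteq> hdeg V (n - 1)) \<and>
     (\<forall>v\<in>carrier V. dif V (dif V v) = \<zero>\<^bsub>V\<^esub>)"

definition dg_map ::
  "'k ring \<Rightarrow> ('k, 'v, 'x) dg_scheme \<Rightarrow> ('k, 'w, 'y) dg_scheme \<Rightarrow> ('v \<Rightarrow> 'w) \<Rightarrow> bool" where
  "dg_map k V W f \<longleftrightarrow>
     linear_map k V W f \<and>
     (\<forall>n. f ` hdeg V n \<subseteq> hdeg W n) \<and>
     (\<forall>v\<in>carrier V. f (dif V v) = dif W (f v))"

text \<open>The two clauses say that the map induced on homology is surjective and injective.\<close>

definition quasi_iso ::
  "'k ring \<Rightarrow> ('k, 'v, 'x) dg_scheme \<Rightarrow> ('k, 'w, 'y) dg_scheme \<Rightarrow> ('v \<Rightarrow> 'w) \<Rightarrow> bool" where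
  "quasi_iso k V W f \<longleftrightarrow>
     dg_map k V W f \<and>
     (\<forall>w\<in>carrier W. dif W w = \<zero>\<^bsub>W\<^esub> \<longrightarrow>
        (\<exists>v\<in>carrier V. dif V v = \<zero>\<^bsub>V\<^esub> \<and> w \<ominus>\<^bsub>W\<^esub> f v \<in> dif W ` carrier W)) \<and>
     (\<forall>v\<in>carrier V. dif V v = \<zero>\<^bsub>V\<^esub> \<and> f v \<in> dif W ` carrier W \<longrightarrow> v \<in> dif V ` carrier V)"

definition ground_dg :: "'k ring \<Rightarrow> ('k, 'k) dg" where
  "ground_dg k = \<lparr>carrier = carrier k, monoid.mult = monoid.mult k, monoid.one = \<one>\<^bsub>k\<^esub>,
     ring.zero = \<zero>\<^bsub>k\<^esub>, ring.add = ring.add k, smult = monoid.mult k,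
     hdeg = (\<lambda>n. if n = 0 then carrier k else {\<zero>\<^bsub>k\<^esub>}), dif = (\<lambda>_. \<zero>\<^bsub>k\<^esub>)\<rparr>"

definition ksign :: "('v, 'x) ring_scheme \<Rightarrow> int \<Rightarrow> 'v \<Rightarrow> 'v" where
  "ksign V e v = (if even e then v else \<ominus>\<^bsub>V\<^esub> v)"


section \<open>Operads and their algebras\<close>

text \<open>Symmetric operads in dg vector spaces, presented by partial compositions. Inputs are numbered
  from \<open>0\<close>: for \<open>x\<close> of arity \<open>r\<close>, \<open>y\<close> of arity \<open>s\<close> and \<open>i < r\<close>, the element \<open>pcomp Op r s i x y\<close> of
  arity \<open>r + s - 1\<close> is \<open>y\<close> plugged into input \<open>i\<close> of \<open>x\<close>. The element \<open>sact Op r \<sigma> x\<close> is \<open>x \<cdot> \<sigma>\<close> for the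
  right action of the permutations of \<open>{..<r}\<close>.\<close>

record ('k, 'o) operad =
  ops :: "nat \<Rightarrow> ('k, 'o) dg"
  unt :: "'o"
  pcomp :: "nat \<Rightarrow> nat \<Rightarrow> nat \<Rightarrow> 'o \<Rightarrow> 'o \<Rightarrow> 'o"
  sact :: "nat \<Rightarrow> (nat \<Rightarrow> nat) \<Rightarrow> 'o \<Rightarrow> 'o"

text \<open>The permutation \<open>\<rho>\<close> with \<open>(x \<cdot> \<sigma>) \<circ>\<^sub>i (y \<cdot> \<tau>) = (x \<circ>\<^bsub>\<sigma> i\<^esub> y) \<cdot> \<rho>\<close>. By the convention
  \<open>(x \<cdot> \<sigma>)(a\<^sub>0, a\<^sub>1, \<dots>) = \<plusminus> x (a\<^bsub>\<sigma>\<^sup>-\<^sup>1 0\<^esub>, a\<^bsub>\<sigma>\<^sup>-\<^sup>1 1\<^esub>, \<dots>)\<close> used for algebras below, the \<open>m\<close>-th entry of the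
  following list is the input of the left-hand side that ends up in slot \<open>m\<close> of \<open>x \<circ>\<^bsub>\<sigma> i\<^esub> y\<close>,
  i.e. it is \<open>\<rho>\<^sup>-\<^sup>1 m\<close>.\<close>

definition pcomp_order ::
  "nat \<Rightarrow> nat \<Rightarrow> nat \<Rightarrow> (nat \<Rightarrow> nat) \<Rightarrow> (nat \<Rightarrow> nat) \<Rightarrow> nat list" where
  "pcomp_order r s i \<sigma> \<tau> = concat (map (\<lambda>j.
     let l = inv_into UNIV \<sigma> j in
     if l = i then map (\<lambda>t. i + inv_into UNIV \<tau> t) [0..<s]
     else if l < i then [l] else [l + s - 1]) [0..<r])"

definition pcomp_perm ::
  "nat \<Rightarrow> nat \<Rightarrow> nat \<Rightarrow> (nat \<Rightarrow> nat) \<Rightarrow> (nat \<Rightarrow> nat) \<Rightarrow> nat \<Rightarrow> nat" where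
  "pcomp_perm r s i \<sigma> \<tau> =
     inv_into UNIV (\<lambda>m. if m < r + s - 1 then pcomp_order r s i \<sigma> \<tau> ! m else m)"

definition is_operad :: "'k ring \<Rightarrow> ('k, 'o) operad \<Rightarrow> bool" where
  "is_operad k Op \<longleftrightarrow>
     (\<forall>r. dg_space k (ops Op r)) \<and>
     unt Op \<in> hdeg (ops Op 1) 0 \<and> dif (ops Op 1) (unt Op) = \<zero>\<^bsub>ops Op 1\<^esub> \<and>
     \<comment> \<open>partial compositions are chain maps \<open>Op(r) \<otimes> Op(s) \<rightarrow> Op(r + s - 1)\<close>\<close>
     (\<forall>r s i. i < r \<longrightarrow>
        (\<forall>y\<in>carrier (ops Op s).
           linear_map k (ops Op r) (ops Op (r + s - 1)) (\<lambda>x. pcomp Op r s i x y)) \<and>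
        (\<forall>x\<in>carrier (ops Op r).
           linear_map k (ops Op s) (ops Op (r + s - 1)) (pcomp Op r s i x)) \<and>
        (\<forall>p q. \<forall>x\<in>hdeg (ops Op r) p. \<forall>y\<in>hdeg (ops Op s) q.
           pcomp Op r s i x y \<in> hdeg (ops Op (r + s - 1)) (p + q) \<and>
           dif (ops Op (r + s - 1)) (pcomp Op r s i x y) =
             pcomp Op r s i (dif (ops Op r) x) y \<oplus>\<^bsub>ops Op (r + s - 1)\<^esub>
             ksign (ops Op (r + s - 1)) p (pcomp Op r s i x (dif (ops Op s) y)))) \<and>
     \<comment> \<open>units\<close>
     (\<forall>r. \<forall>x\<in>carrier (ops Op r). pcomp Op 1 r 0 (unt Op) x = x \<and>
        (\<forall>i<r. pcomp Op r 1 i x (unt Op) = x)) \<and>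
     \<comment> \<open>sequential associativity\<close>
     (\<forall>l m n i j. i < l \<longrightarrow> j < m \<longrightarrow>
        (\<forall>x\<in>carrier (ops Op l). \<forall>y\<in>carrier (ops Op m). \<forall>z\<in>carrier (ops Op n).
           pcomp Op l (m + n - 1) i x (pcomp Op m n j y z) =
           pcomp Op (l + m - 1) n (i + j) (pcomp Op l m i x y) z)) \<and>
     \<comment> \<open>parallel associativity\<close>
     (\<forall>l m n i j p q. i < j \<longrightarrow> j < l \<longrightarrow>
        (\<forall>x\<in>carrier (ops Op l). \<forall>y\<in>hdeg (ops Op m) p. \<forall>z\<in>hdeg (ops Op n) q.
           pcomp Op (l + m - 1) n (j + m - 1) (pcomp Op l m i x y) z =
           ksign (ops Op (l + m - 1 + n - 1)) (p * q)
             (pcomp Op (l + n - 1) m i (pcomp Op l n j x z) y))) \<and>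
     \<comment> \<open>symmetric group actions and equivariance\<close>
     (\<forall>r \<sigma>. \<sigma> permutes {..<r} \<longrightarrow> dg_map k (ops Op r) (ops Op r) (sact Op r \<sigma>)) \<and>
     (\<forall>r. \<forall>x\<in>carrier (ops Op r). sact Op r id x = x \<and>
        (\<forall>\<sigma> \<tau>. \<sigma> permutes {..<r} \<longrightarrow> \<tau> permutes {..<r} \<longrightarrow>
           sact Op r \<tau> (sact Op r \<sigma> x) = sact Op r (\<sigma> \<circ> \<tau>) x)) \<and>
     (\<forall>r s i \<sigma> \<tau>. i < r \<longrightarrow> \<sigma> permutes {..<r} \<longrightarrow> \<tau> permutes {..<s} \<longrightarrow>
        (\<forall>x\<in>carrier (ops Op r). \<forall>y\<in>carrier (ops Op s).
           pcomp Op r s i (sact Op r \<sigma> x) (sact Op s \<tau> y) =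
           sact Op (r + s - 1) (pcomp_perm r s i \<sigma> \<tau>) (pcomp Op r s (\<sigma> i) x y)))"

text \<open>An \<open>E\<^sub>\<infinity>\<close>-operad is an operad with a morphism to the commutative operad (which is \<open>k\<close> in every
  arity) that is a quasi-isomorphism in every arity, such that every \<open>Op(r)\<close> is a graded free right
  module over the group algebra \<open>k[\<Sigma>\<^sub>r]\<close>.\<close>

definition acyclic_operad :: "'k ring \<Rightarrow> ('k, 'o) operad \<Rightarrow> bool" where
  "acyclic_operad k Op \<longleftrightarrow>
     (\<exists>\<epsilon> :: nat \<Rightarrow> 'o \<Rightarrow> 'k.
        (\<forall>r. quasi_iso k (ops Op r) (ground_dg k) (\<epsilon> r)) \<and>
        \<epsilon> 1 (unt Op) = \<one>\<^bsub>k\<^esub> \<and>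
        (\<forall>r s i. i < r \<longrightarrow> (\<forall>x\<in>carrier (ops Op r). \<forall>y\<in>carrier (ops Op s).
           \<epsilon> (r + s - 1) (pcomp Op r s i x y) = \<epsilon> r x \<otimes>\<^bsub>k\<^esub> \<epsilon> s y)) \<and>
        (\<forall>r \<sigma>. \<sigma> permutes {..<r} \<longrightarrow> (\<forall>x\<in>carrier (ops Op r). \<epsilon> r (sact Op r \<sigma> x) = \<epsilon> r x)))"

definition symmetric_free :: "'k ring \<Rightarrow> ('k, 'o) operad \<Rightarrow> bool" where
  "symmetric_free k Op \<longleftrightarrow>
     (\<forall>r. \<exists>S \<subseteq> (\<Union>n. hdeg (ops Op r) n). \<forall>x\<in>carrier (ops Op r).
        \<exists>!c :: 'o \<times> (nat \<Rightarrow> nat) \<Rightarrow> 'k.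
          range c \<subseteq> carrier k \<and> finite {b. c b \<noteq> \<zero>\<^bsub>k\<^esub>} \<and>
          {b. c b \<noteq> \<zero>\<^bsub>k\<^esub>} \<subseteq> S \<times> {\<sigma>. \<sigma> permutes {..<r}} \<and>
          x = (\<Oplus>\<^bsub>ops Op r\<^esub>b\<in>{b. c b \<noteq> \<zero>\<^bsub>k\<^esub>}.
                 c b \<odot>\<^bsub>ops Op r\<^esub> sact Op r (snd b) (fst b)))"

definition einf_operad :: "'k ring \<Rightarrow> ('k, 'o) operad \<Rightarrow> bool" where
  "einf_operad k Op \<longleftrightarrow> is_operad k Op \<and> acyclic_operad k Op \<and> symmetric_free k Op"

text \<open>An operation of arity \<open>r\<close> acts on lists of length \<open>r\<close>.\<close>

record ('k, 'o, 'v) alg = "('k, 'v) dg" +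
  act :: "'o \<Rightarrow> 'v list \<Rightarrow> 'v"

definition homogeneous :: "('k, 'v, 'x) dg_scheme \<Rightarrow> 'v list \<Rightarrow> int list \<Rightarrow> bool" where
  "homogeneous A vs ns \<longleftrightarrow> list_all2 (\<lambda>v n. v \<in> hdeg A n) vs ns"

definition op_alg :: "'k ring \<Rightarrow> ('k, 'o) operad \<Rightarrow> ('k, 'o, 'v) alg \<Rightarrow> bool" where
  "op_alg k Op A \<longleftrightarrow>
     dg_space k A \<and>
     \<comment> \<open>the action is multilinear, of degree \<open>0\<close> and compatible with the differentials\<close>
     (\<forall>vs. set vs \<subseteq> carrier A \<longrightarrow>
        linear_map k (ops Op (length vs)) A (\<lambda>x. act A x vs) \<and>
        (\<forall>x\<in>carrier (ops Op (length vs)). \<forall>i<length vs.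
           linear_map k A A (\<lambda>v. act A x (vs[i := v])))) \<and>
     (\<forall>p x vs ns. x \<in> hdeg (ops Op (length vs)) p \<longrightarrow> homogeneous A vs ns \<longrightarrow>
        act A x vs \<in> hdeg A (p + sum_list ns) \<and>
        dif A (act A x vs) =
          act A (dif (ops Op (length vs)) x) vs \<oplus>\<^bsub>A\<^esub>
          (\<Oplus>\<^bsub>A\<^esub>i\<in>{..<length vs}.
             ksign A (p + sum_list (take i ns)) (act A x (vs[i := dif A (vs ! i)])))) \<and>
     \<comment> \<open>unit\<close>
     (\<forall>v\<in>carrier A. act A (unt Op) [v] = v) \<and>
     \<comment> \<open>compatibility with partial composition\<close>
     (\<forall>r s i q x y vs ns. i < r \<longrightarrow> x \<in> carrier (ops Op r) \<longrightarrow> y \<in> hdeg (ops Op s) q \<longrightarrow>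
        length vs = r + s - 1 \<longrightarrow> homogeneous A vs ns \<longrightarrow>
        act A (pcomp Op r s i x y) vs =
          ksign A (q * sum_list (take i ns))
            (act A x (take i vs @ [act A y (take s (drop i vs))] @ drop (i + s) vs))) \<and>
     \<comment> \<open>equivariance, with the Koszul sign of the permutation\<close>
     (\<forall>\<sigma> x vs ns. \<sigma> permutes {..<length vs} \<longrightarrow> x \<in> carrier (ops Op (length vs)) \<longrightarrow>
        homogeneous A vs ns \<longrightarrow>
        act A (sact Op (length vs) \<sigma> x) vs =
          ksign A (\<Sum>(i, j) | i < j \<and> j < length vs \<and> \<sigma> j < \<sigma> i. ns ! i * ns ! j)
            (act A x (map (\<lambda>j. vs ! inv_into UNIV \<sigma> j) [0..<length vs])))"

text \<open>Morphisms are extensional functions, so that equality of morphisms is equality of functions;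
  they are composed with \<^const>\<open>compose\<close>.\<close>

definition alg_hom ::
  "'k ring \<Rightarrow> ('k, 'o) operad \<Rightarrow> ('k, 'o, 'v) alg \<Rightarrow> ('k, 'o, 'v) alg \<Rightarrow> ('v \<Rightarrow> 'v) set" where
  "alg_hom k Op A B = {f \<in> extensional (carrier A). dg_map k A B f \<and>
     (\<forall>vs. set vs \<subseteq> carrier A \<longrightarrow> (\<forall>x\<in>carrier (ops Op (length vs)).
        f (act A x vs) = act B x (map f vs)))}"

definition alg_id :: "('k, 'o, 'v) alg \<Rightarrow> 'v \<Rightarrow> 'v" where
  "alg_id A = (\<lambda>v\<in>carrier A. v)"

definition alg_iso ::
  "'k ring \<Rightarrow> ('k, 'o) operad \<Rightarrow> ('k, 'o, 'v) alg \<Rightarrow> ('k, 'o, 'v) alg \<Rightarrow> ('v \<Rightarrow> 'v) set" where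
  "alg_iso k Op A B = {f \<in> alg_hom k Op A B. \<exists>g\<in>alg_hom k Op B A.
     compose (carrier A) g f = alg_id A \<and> compose (carrier B) f g = alg_id B}"


section \<open>The model structure on algebras\<close>

text \<open>The model structure induced from the projective one on dg vector spaces: weak equivalences are
  the quasi-isomorphisms, fibrations the surjections, and cofibrations are determined by lifting.\<close>

definition weq where
  "weq k Op A B f \<longleftrightarrow> f \<in> alg_hom k Op A B \<and> quasi_iso k A B f"

definition fibration where
  "fibration k Op A B f \<longleftrightarrow> f \<in> alg_hom k Op A B \<and> f ` carrier A = carrier B"

definition cofibration ::
  "'k ring \<Rightarrow> ('k, 'o) operad \<Rightarrow> ('k, 'o, 'v) alg \<Rightarrow> ('k, 'o, 'v) alg \<Rightarrow> ('v \<Rightarrow> 'v) \<Rightarrow> bool" where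
  "cofibration k Op A B i \<longleftrightarrow> i \<in> alg_hom k Op A B \<and>
     (\<forall>(X :: ('k, 'o, 'v) alg) Y p u v.
        op_alg k Op X \<longrightarrow> op_alg k Op Y \<longrightarrow> fibration k Op X Y p \<longrightarrow> weq k Op X Y p \<longrightarrow>
        u \<in> alg_hom k Op A X \<longrightarrow> v \<in> alg_hom k Op B Y \<longrightarrow>
        compose (carrier A) p u = compose (carrier A) v i \<longrightarrow>
        (\<exists>h\<in>alg_hom k Op B X. compose (carrier A) h i = u \<and> compose (carrier B) p h = v))"

definition initial_alg :: "'k ring \<Rightarrow> ('k, 'o) operad \<Rightarrow> ('k, 'o, 'v) alg \<Rightarrow> bool" where
  "initial_alg k Op I \<longleftrightarrow> op_alg k Op I \<and>
     (\<forall>B :: ('k, 'o, 'v) alg. op_alg k Op B \<longrightarrow> (\<exists>!f. f \<in> alg_hom k Op I B))"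

definition cofibrant :: "'k ring \<Rightarrow> ('k, 'o) operad \<Rightarrow> ('k, 'o, 'v) alg \<Rightarrow> bool" where
  "cofibrant k Op A \<longleftrightarrow> op_alg k Op A \<and>
     (\<exists>(I :: ('k, 'o, 'v) alg) i. initial_alg k Op I \<and> cofibration k Op I A i)"

text \<open>A functorial cofibrant replacement: a functor \<open>Q\<close> (\<open>qob\<close> on objects, \<open>qmor A B\<close> on morphisms
  \<open>A \<rightarrow> B\<close>) with cofibrant values and a natural weak equivalence \<open>qtr A : Q A \<rightarrow> A\<close>.\<close>

record ('k, 'o, 'v) replacement =
  qob :: "('k, 'o, 'v) alg \<Rightarrow> ('k, 'o, 'v) alg"
  qmor :: "('k, 'o, 'v) alg \<Rightarrow> ('k, 'o, 'v) alg \<Rightarrow> ('v \<Rightarrow> 'v) \<Rightarrow> 'v \<Rightarrow> 'v"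
  qtr :: "('k, 'o, 'v) alg \<Rightarrow> 'v \<Rightarrow> 'v"

definition cofibrant_replacement ::
  "'k ring \<Rightarrow> ('k, 'o) operad \<Rightarrow> ('k, 'o, 'v) replacement \<Rightarrow> bool" where
  "cofibrant_replacement k Op Q \<longleftrightarrow>
     (\<forall>A. op_alg k Op A \<longrightarrow> cofibrant k Op (qob Q A) \<and> weq k Op (qob Q A) A (qtr Q A) \<and>
        qmor Q A A (alg_id A) = alg_id (qob Q A)) \<and>
     (\<forall>A B f. op_alg k Op A \<longrightarrow> op_alg k Op B \<longrightarrow> f \<in> alg_hom k Op A B \<longrightarrow>
        qmor Q A B f \<in> alg_hom k Op (qob Q A) (qob Q B) \<and>
        compose (carrier (qob Q A)) (qtr Q B) (qmor Q A B f) =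
          compose (carrier (qob Q A)) f (qtr Q A)) \<and>
     (\<forall>A B C f g. op_alg k Op A \<longrightarrow> op_alg k Op B \<longrightarrow> op_alg k Op C \<longrightarrow>
        f \<in> alg_hom k Op A B \<longrightarrow> g \<in> alg_hom k Op B C \<longrightarrow>
        qmor Q A C (compose (carrier A) g f) =
          compose (carrier (qob Q A)) (qmor Q B C g) (qmor Q A B f))"


section \<open>Simplicial sets\<close>

text \<open>\<open>ord_maps m n\<close> are the morphisms \<open>[m] \<rightarrow> [n]\<close> of the simplex category; \<open>\<alpha> \<in> ord_maps m n\<close>
  acts on a simplicial set as \<open>sop K m n \<alpha> : K\<^sub>n \<rightarrow> K\<^sub>m\<close>.\<close>

definition ord_maps :: "nat \<Rightarrow> nat \<Rightarrow> (nat \<Rightarrow> nat) set" where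
  "ord_maps m n = {\<alpha> \<in> {..m} \<rightarrow>\<^sub>E {..n}. mono_on {..m} \<alpha>}"

record 's sset =
  simps :: "nat \<Rightarrow> 's set"
  sop :: "nat \<Rightarrow> nat \<Rightarrow> (nat \<Rightarrow> nat) \<Rightarrow> 's \<Rightarrow> 's"

definition is_sset :: "('s, 'x) sset_scheme \<Rightarrow> bool" where
  "is_sset K \<longleftrightarrow>
     (\<forall>m n. \<forall>\<alpha>\<in>ord_maps m n. sop K m n \<alpha> \<in> simps K n \<rightarrow> simps K m) \<and>
     (\<forall>n. \<forall>x\<in>simps K n. sop K n n (\<lambda>j\<in>{..n}. j) x = x) \<and>
     (\<forall>l m n. \<forall>\<alpha>\<in>ord_maps l m. \<forall>\<beta>\<in>ord_maps m n. \<forall>x\<in>simps K n.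
        sop K l n (compose {..l} \<beta> \<alpha>) x = sop K l m \<alpha> (sop K m n \<beta> x))"

definition sset_hom ::
  "('s, 'x) sset_scheme \<Rightarrow> ('t, 'y) sset_scheme \<Rightarrow> (nat \<Rightarrow> 's \<Rightarrow> 't) set" where
  "sset_hom K L = {\<phi>. (\<forall>n. \<phi> n \<in> simps K n \<rightarrow>\<^sub>E simps L n) \<and>
     (\<forall>m n. \<forall>\<alpha>\<in>ord_maps m n. \<forall>x\<in>simps K n. \<phi> m (sop K m n \<alpha> x) = sop L m n \<alpha> (\<phi> n x))}"

definition sset_id :: "('s, 'x) sset_scheme \<Rightarrow> nat \<Rightarrow> 's \<Rightarrow> 's" where
  "sset_id K = (\<lambda>n. \<lambda>x\<in>simps K n. x)"

definition sset_comp ::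
  "('s, 'x) sset_scheme \<Rightarrow> (nat \<Rightarrow> 't \<Rightarrow> 'u) \<Rightarrow> (nat \<Rightarrow> 's \<Rightarrow> 't) \<Rightarrow> nat \<Rightarrow> 's \<Rightarrow> 'u" where
  "sset_comp K \<psi> \<phi> = (\<lambda>n. compose (simps K n) (\<psi> n) (\<phi> n))"

definition sset_iso ::
  "('s, 'x) sset_scheme \<Rightarrow> ('t, 'y) sset_scheme \<Rightarrow> (nat \<Rightarrow> 's \<Rightarrow> 't) set" where
  "sset_iso K L = {\<phi> \<in> sset_hom K L. \<exists>\<psi>\<in>sset_hom L K.
     sset_comp K \<psi> \<phi> = sset_id K \<and> sset_comp L \<phi> \<psi> = sset_id L}"

definition simplex :: "nat \<Rightarrow> (nat \<Rightarrow> nat) sset" where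
  "simplex n = \<lparr>simps = (\<lambda>m. ord_maps m n), sop = (\<lambda>l m \<alpha> \<beta>. compose {..l} \<beta> \<alpha>)\<rparr>"

definition boundary :: "nat \<Rightarrow> (nat \<Rightarrow> nat) sset" where
  "boundary n = (simplex n)\<lparr>simps := (\<lambda>m. {\<alpha>\<in>ord_maps m n. \<not> {..n} \<subseteq> \<alpha> ` {..m}})\<rparr>"

definition horn :: "nat \<Rightarrow> nat \<Rightarrow> (nat \<Rightarrow> nat) sset" where
  "horn n j = (simplex n)\<lparr>simps := (\<lambda>m. {\<alpha>\<in>ord_maps m n. \<not> {..n} - {j} \<subseteq> \<alpha> ` {..m}})\<rparr>"

text \<open>The right lifting property against an inclusion \<open>L \<subseteq> \<Delta>\<^sup>n\<close>.\<close>

definition lifts_against ::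
  "nat \<Rightarrow> (nat \<Rightarrow> nat) sset \<Rightarrow> 's sset \<Rightarrow> 't sset \<Rightarrow> (nat \<Rightarrow> 's \<Rightarrow> 't) \<Rightarrow> bool" where
  "lifts_against n L X Y \<phi> \<longleftrightarrow>
     (\<forall>u\<in>sset_hom L X. \<forall>v\<in>sset_hom (simplex n) Y.
        sset_comp L \<phi> u = sset_comp L v (sset_id L) \<longrightarrow>
        (\<exists>h\<in>sset_hom (simplex n) X.
           sset_comp L h (sset_id L) = u \<and> sset_comp (simplex n) \<phi> h = v))"

definition kan_fibration :: "'s sset \<Rightarrow> 't sset \<Rightarrow> (nat \<Rightarrow> 's \<Rightarrow> 't) \<Rightarrow> bool" where
  "kan_fibration X Y \<phi> \<longleftrightarrow> \<phi> \<in> sset_hom X Y \<and>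
     (\<forall>n\<ge>1. \<forall>j\<le>n. lifts_against n (horn n j) X Y \<phi>)"

definition trivial_kan_fibration :: "'s sset \<Rightarrow> 't sset \<Rightarrow> (nat \<Rightarrow> 's \<Rightarrow> 't) \<Rightarrow> bool" where
  "trivial_kan_fibration X Y \<phi> \<longleftrightarrow> \<phi> \<in> sset_hom X Y \<and>
     (\<forall>n. lifts_against n (boundary n) X Y \<phi>)"

definition sset_pullback ::
  "'s sset \<Rightarrow> 't sset \<Rightarrow> (nat \<Rightarrow> 's \<Rightarrow> 'u) \<Rightarrow> (nat \<Rightarrow> 't \<Rightarrow> 'u) \<Rightarrow> ('s \<times> 't) sset" where
  "sset_pullback K L \<phi> \<psi> =
     \<lparr>simps = (\<lambda>n. {(x, y). x \<in> simps K n \<and> y \<in> simps L n \<and> \<phi> n x = \<psi> n y}),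
      sop = (\<lambda>m n \<alpha> (x, y). (sop K m n \<alpha> x, sop L m n \<alpha> y))\<rparr>"

text \<open>Transport along an injection into a type \<open>'s\<close> that serves as the universe of simplices of the
  simplicial sets one tensors with.\<close>

definition relabel :: "('q \<Rightarrow> 's) \<Rightarrow> ('q, 'x) sset_scheme \<Rightarrow> 's sset" where
  "relabel c K = \<lparr>simps = (\<lambda>n. c ` simps K n),
     sop = (\<lambda>m n \<alpha> s. c (sop K m n \<alpha> (inv_into (simps K n) c s)))\<rparr>"

definition relabel_map ::
  "('q \<Rightarrow> 's) \<Rightarrow> ('p \<Rightarrow> 's) \<Rightarrow> ('q, 'x) sset_scheme \<Rightarrow> (nat \<Rightarrow> 'q \<Rightarrow> 'p) \<Rightarrow> nat \<Rightarrow> 's \<Rightarrow> 's" where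
  "relabel_map c c' K \<phi> = (\<lambda>n. \<lambda>s\<in>c ` simps K n. c' (\<phi> n (inv_into (simps K n) c s)))"


section \<open>The tensoring over simplicial sets\<close>

text \<open>\<open>tob T K A\<close> is \<open>K \<otimes> A\<close> and \<open>tmor T K L \<phi> A B f\<close> is \<open>\<phi> \<otimes> f : K \<otimes> A \<rightarrow> L \<otimes> B\<close>. Throughout,
  \<open>std\<close> is an injection placing the standard simplices into the universe \<open>'s\<close>.\<close>

record ('k, 'o, 'v, 's) tensoring =
  tob :: "'s sset \<Rightarrow> ('k, 'o, 'v) alg \<Rightarrow> ('k, 'o, 'v) alg"
  tmor :: "'s sset \<Rightarrow> 's sset \<Rightarrow> (nat \<Rightarrow> 's \<Rightarrow> 's) \<Rightarrow>
    ('k, 'o, 'v) alg \<Rightarrow> ('k, 'o, 'v) alg \<Rightarrow> ('v \<Rightarrow> 'v) \<Rightarrow> 'v \<Rightarrow> 'v"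

definition Delta :: "((nat \<Rightarrow> nat) \<Rightarrow> 's) \<Rightarrow> nat \<Rightarrow> 's sset" where
  "Delta std n = relabel std (simplex n)"

definition Delta_map :: "((nat \<Rightarrow> nat) \<Rightarrow> 's) \<Rightarrow> nat \<Rightarrow> nat \<Rightarrow> (nat \<Rightarrow> nat) \<Rightarrow> nat \<Rightarrow> 's \<Rightarrow> 's" where
  "Delta_map std m n \<alpha> = relabel_map std std (simplex m) (\<lambda>l \<beta>. compose {..l} \<alpha> \<beta>)"

definition classify :: "((nat \<Rightarrow> nat) \<Rightarrow> 's) \<Rightarrow> 's sset \<Rightarrow> nat \<Rightarrow> 's \<Rightarrow> nat \<Rightarrow> 's \<Rightarrow> 's" where
  "classify std K n x = relabel_map std id (simplex n) (\<lambda>m \<beta>. sop K m n \<beta> x)"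

definition map_space ::
  "'k ring \<Rightarrow> ('k, 'o) operad \<Rightarrow> ((nat \<Rightarrow> nat) \<Rightarrow> 's) \<Rightarrow> ('k, 'o, 'v, 's) tensoring \<Rightarrow>
   ('k, 'o, 'v) alg \<Rightarrow> ('k, 'o, 'v) alg \<Rightarrow> ('v \<Rightarrow> 'v) sset" where
  "map_space k Op std T A B =
     \<lparr>simps = (\<lambda>n. alg_hom k Op (tob T (Delta std n) A) B),
      sop = (\<lambda>m n \<alpha> f. compose (carrier (tob T (Delta std m) A)) f
        (tmor T (Delta std m) (Delta std n) (Delta_map std m n \<alpha>) A A (alg_id A)))\<rparr>"

definition map_post where
  "map_post std T A p = (\<lambda>n f. compose (carrier (tob T (Delta std n) A)) p f)"

definition map_pre where
  "map_pre std T A B i = (\<lambda>n f. compose (carrier (tob T (Delta std n) A)) f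
     (tmor T (Delta std n) (Delta std n) (sset_id (Delta std n)) A B i))"

text \<open>A tensoring is a functor \<open>\<otimes>\<close> of two variables with \<open>\<Delta>\<^sup>0 \<otimes> A \<cong> A\<close> and, for the mapping spaces
  \<open>Map(A, B)\<^sub>n = Hom(\<Delta>\<^sup>n \<otimes> A, B)\<close>, the adjunction \<open>Hom(K \<otimes> A, B) \<cong> Hom(K, Map(A, B))\<close>. It is
  compatible with the model structure if it satisfies the pullback-corner axiom (SM7). Both
  conditions hold in every simplicial model category; the associativity constraint
  \<open>(K \<times> L) \<otimes> A \<cong> K \<otimes> (L \<otimes> A)\<close>, which for models of \<open>E\<^sub>\<infinity>\<close>-algebras may hold only up to weak
  equivalence, is not required.\<close>

definition is_tensoring ::
  "'k ring \<Rightarrow> ('k, 'o) operad \<Rightarrow> ((nat \<Rightarrow> nat) \<Rightarrow> 's) \<Rightarrow> ('k, 'o, 'v, 's) tensoring \<Rightarrow> bool" where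
  "is_tensoring k Op std T \<longleftrightarrow>
     (\<forall>K A. is_sset K \<longrightarrow> op_alg k Op A \<longrightarrow> op_alg k Op (tob T K A) \<and>
        tmor T K K (sset_id K) A A (alg_id A) = alg_id (tob T K A)) \<and>
     (\<forall>K L A B. is_sset K \<longrightarrow> is_sset L \<longrightarrow> op_alg k Op A \<longrightarrow> op_alg k Op B \<longrightarrow>
        (\<forall>\<phi>\<in>sset_hom K L. \<forall>f\<in>alg_hom k Op A B.
           tmor T K L \<phi> A B f \<in> alg_hom k Op (tob T K A) (tob T L B))) \<and>
     (\<forall>K L M A B C. is_sset K \<longrightarrow> is_sset L \<longrightarrow> is_sset M \<longrightarrow>
        op_alg k Op A \<longrightarrow> op_alg k Op B \<longrightarrow> op_alg k Op C \<longrightarrow>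
        (\<forall>\<phi>\<in>sset_hom K L. \<forall>\<psi>\<in>sset_hom L M. \<forall>f\<in>alg_hom k Op A B. \<forall>g\<in>alg_hom k Op B C.
           tmor T K M (sset_comp K \<psi> \<phi>) A C (compose (carrier A) g f) =
           compose (carrier (tob T K A)) (tmor T L M \<psi> B C g) (tmor T K L \<phi> A B f))) \<and>
     (\<exists>u. (\<forall>A. op_alg k Op A \<longrightarrow> u A \<in> alg_iso k Op (tob T (Delta std 0) A) A) \<and>
        (\<forall>A B. op_alg k Op A \<longrightarrow> op_alg k Op B \<longrightarrow> (\<forall>f\<in>alg_hom k Op A B.
           compose (carrier (tob T (Delta std 0) A)) (u B)
             (tmor T (Delta std 0) (Delta std 0) (sset_id (Delta std 0)) A B f) =
           compose (carrier (tob T (Delta std 0) A)) f (u A)))) \<and>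
     (\<forall>K A B. is_sset K \<longrightarrow> op_alg k Op A \<longrightarrow> op_alg k Op B \<longrightarrow>
        bij_betw (\<lambda>f n. \<lambda>x\<in>simps K n. compose (carrier (tob T (Delta std n) A)) f
            (tmor T (Delta std n) K (classify std K n x) A A (alg_id A)))
          (alg_hom k Op (tob T K A) B) (sset_hom K (map_space k Op std T A B)))"

definition corner_map where
  "corner_map k Op std T A B X i p = (\<lambda>n. \<lambda>f\<in>simps (map_space k Op std T B X) n.
     (map_pre std T A B i n f, map_post std T B p n f))"

definition corner_space where
  "corner_space k Op std T A B X Y i p =
     sset_pullback (map_space k Op std T A X) (map_space k Op std T B Y)
       (map_post std T A p) (map_pre std T A B i)"

definition tensoring_SM7 ::
  "'k ring \<Rightarrow> ('k, 'o) operad \<Rightarrow> ((nat \<Rightarrow> nat) \<Rightarrow> 's) \<Rightarrow> ('k, 'o, 'v, 's) tensoring \<Rightarrow> bool" where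
  "tensoring_SM7 k Op std T \<longleftrightarrow>
     (\<forall>A B X Y i p. op_alg k Op A \<longrightarrow> op_alg k Op B \<longrightarrow> op_alg k Op X \<longrightarrow> op_alg k Op Y \<longrightarrow>
        cofibration k Op A B i \<longrightarrow> fibration k Op X Y p \<longrightarrow>
        kan_fibration (map_space k Op std T B X) (corner_space k Op std T A B X Y i p)
          (corner_map k Op std T A B X i p) \<and>
        (weq k Op A B i \<or> weq k Op X Y p \<longrightarrow>
           trivial_kan_fibration (map_space k Op std T B X) (corner_space k Op std T A B X Y i p)
             (corner_map k Op std T A B X i p)))"

text \<open>A geometric realization of a simplicial object \<open>B\<close>, i.e. a coend \<open>\<integral>\<^sup>m \<Delta>\<^sup>m \<otimes> B\<^sub>m\<close>, consists of
  an object \<open>R\<close> and a universal family \<open>\<iota>\<^sub>m : \<Delta>\<^sup>m \<otimes> B\<^sub>m \<rightarrow> R\<close>. Here \<open>Bop m n \<alpha> : B\<^sub>n \<rightarrow> B\<^sub>m\<close> for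
  \<open>\<alpha> : [m] \<rightarrow> [n]\<close>.\<close>

definition dinatural where
  "dinatural k Op std T B Bop R \<iota> \<longleftrightarrow> op_alg k Op R \<and>
     (\<forall>m. \<iota> m \<in> alg_hom k Op (tob T (Delta std m) (B m)) R) \<and>
     (\<forall>m n. \<forall>\<alpha>\<in>ord_maps m n.
        compose (carrier (tob T (Delta std m) (B n))) (\<iota> m)
          (tmor T (Delta std m) (Delta std m) (sset_id (Delta std m)) (B n) (B m) (Bop m n \<alpha>)) =
        compose (carrier (tob T (Delta std m) (B n))) (\<iota> n)
          (tmor T (Delta std m) (Delta std n) (Delta_map std m n \<alpha>) (B n) (B n) (alg_id (B n))))"

definition is_realization ::
  "'k ring \<Rightarrow> ('k, 'o) operad \<Rightarrow> ((nat \<Rightarrow> nat) \<Rightarrow> 's) \<Rightarrow> ('k, 'o, 'v, 's) tensoring \<Rightarrow>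
   (nat \<Rightarrow> ('k, 'o, 'v) alg) \<Rightarrow> (nat \<Rightarrow> nat \<Rightarrow> (nat \<Rightarrow> nat) \<Rightarrow> 'v \<Rightarrow> 'v) \<Rightarrow>
   ('k, 'o, 'v) alg \<Rightarrow> (nat \<Rightarrow> 'v \<Rightarrow> 'v) \<Rightarrow> bool" where
  "is_realization k Op std T B Bop R \<iota> \<longleftrightarrow> dinatural k Op std T B Bop R \<iota> \<and>
     (\<forall>S \<kappa>. dinatural k Op std T B Bop S \<kappa> \<longrightarrow>
        (\<exists>!f. f \<in> alg_hom k Op R S \<and>
           (\<forall>m. compose (carrier (tob T (Delta std m) (B m))) f (\<iota> m) = \<kappa> m)))"


section \<open>Equivariant higher Hochschild chains\<close>

definition equivariant_alg ::
  "'k ring \<Rightarrow> ('k, 'o) operad \<Rightarrow> 'g monoid \<Rightarrow> ('k, 'o, 'v) alg \<Rightarrow> ('g \<Rightarrow> 'v \<Rightarrow> 'v) \<Rightarrow> bool" where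
  "equivariant_alg k Op G A \<rho> \<longleftrightarrow> op_alg k Op A \<and>
     (\<forall>g\<in>carrier G. \<rho> g \<in> alg_hom k Op A A) \<and>
     \<rho> \<one>\<^bsub>G\<^esub> = alg_id A \<and>
     (\<forall>g\<in>carrier G. \<forall>h\<in>carrier G. \<rho> (g \<otimes>\<^bsub>G\<^esub> h) = compose (carrier A) (\<rho> g) (\<rho> h))"

record ('q, 'g) gsset = "'q sset" +
  ract :: "nat \<Rightarrow> 'q \<Rightarrow> 'g \<Rightarrow> 'q"

definition is_gsset :: "'g monoid \<Rightarrow> ('q, 'g) gsset \<Rightarrow> bool" where
  "is_gsset G E \<longleftrightarrow> is_sset E \<and>
     (\<forall>n. \<forall>x\<in>simps E n. ract E n x \<one>\<^bsub>G\<^esub> = x \<and>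
        (\<forall>g\<in>carrier G. ract E n x g \<in> simps E n \<and>
           (\<forall>h\<in>carrier G. ract E n (ract E n x g) h = ract E n x (g \<otimes>\<^bsub>G\<^esub> h)))) \<and>
     (\<forall>m n. \<forall>\<alpha>\<in>ord_maps m n. \<forall>x\<in>simps E n. \<forall>g\<in>carrier G.
        sop E m n \<alpha> (ract E n x g) = ract E m (sop E m n \<alpha> x) g)"

text \<open>The simplicial set \<open>E \<times> G\<^sup>m\<close>, with \<open>G\<^sup>m\<close> discrete, and its fibre inclusions
  \<open>x \<mapsto> (x \<cdot> g, gs)\<close>, defined on \<open>E = E \<times> G\<^sup>0\<close>.\<close>

definition gtuples :: "'g monoid \<Rightarrow> nat \<Rightarrow> 'g list set" where
  "gtuples G m = {gs. set gs \<subseteq> carrier G \<and> length gs = m}"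

definition gprod :: "'g monoid \<Rightarrow> 'g list \<Rightarrow> 'g" where
  "gprod G gs = foldr (\<lambda>g h. g \<otimes>\<^bsub>G\<^esub> h) gs \<one>\<^bsub>G\<^esub>"

definition bar_sset :: "'g monoid \<Rightarrow> ('q, 'g) gsset \<Rightarrow> nat \<Rightarrow> ('q \<times> 'g list) sset" where
  "bar_sset G E m = \<lparr>simps = (\<lambda>j. simps E j \<times> gtuples G m),
     sop = (\<lambda>i j \<alpha> (x, gs). (sop E i j \<alpha> x, gs))\<rparr>"

definition bar_fibre ::
  "('q, 'g) gsset \<Rightarrow> 'g \<Rightarrow> 'g list \<Rightarrow> nat \<Rightarrow> 'q \<times> 'g list \<Rightarrow> 'q \<times> 'g list" where
  "bar_fibre E g gs = (\<lambda>j (x, _). (ract E j x g, gs))"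

text \<open>The bar construction \<open>B\<^sub>m(E, \<star>//G, QA) = (E \<times> G\<^sup>m) \<otimes> QA\<close>. Its structure map along
  \<open>\<alpha> : [n] \<rightarrow> [m]\<close> sends, informally, \<open>(x, g\<^sub>1, \<dots>, g\<^sub>m; a)\<close> to
  \<open>(x g\<^sub>1\<dots>g\<^bsub>\<alpha>(0)\<^esub>, h\<^sub>1, \<dots>, h\<^sub>n; g\<^bsub>\<alpha>(n)+1\<^esub>\<dots>g\<^sub>m a)\<close> with \<open>h\<^sub>j = g\<^bsub>\<alpha>(j-1)+1\<^esub>\<dots>g\<^bsub>\<alpha>(j)\<^esub>\<close>, which
  gives the usual faces and degeneracies. It is determined by its restrictions to the summands of
  \<open>(E \<times> G\<^sup>m) \<otimes> QA \<cong> \<Coprod>\<^bsub>gs \<in> G\<^sup>m\<^esub> E \<otimes> QA\<close>.\<close>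

definition bar_pull :: "'g monoid \<Rightarrow> nat \<Rightarrow> (nat \<Rightarrow> nat) \<Rightarrow> 'g list \<Rightarrow> 'g list" where
  "bar_pull G n \<alpha> gs = map (\<lambda>j. gprod G (drop (\<alpha> j) (take (\<alpha> (Suc j)) gs))) [0..<n]"

definition bar_ob ::
  "('k, 'o, 'v, 's) tensoring \<Rightarrow> ('k, 'o, 'v) replacement \<Rightarrow> ('q \<times> 'g list \<Rightarrow> 's) \<Rightarrow>
   'g monoid \<Rightarrow> ('q, 'g) gsset \<Rightarrow> ('k, 'o, 'v) alg \<Rightarrow> nat \<Rightarrow> ('k, 'o, 'v) alg" where
  "bar_ob T Q c G E A m = tob T (relabel c (bar_sset G E m)) (qob Q A)"

definition bar_fibre_tensor where
  "bar_fibre_tensor T Q c G E A m g gs f =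
     tmor T (relabel c (bar_sset G E 0)) (relabel c (bar_sset G E m))
       (relabel_map c c (bar_sset G E 0) (bar_fibre E g gs)) (qob Q A) (qob Q A) f"

definition bar_op ::
  "'k ring \<Rightarrow> ('k, 'o) operad \<Rightarrow> ('k, 'o, 'v, 's) tensoring \<Rightarrow> ('k, 'o, 'v) replacement \<Rightarrow>
   ('q \<times> 'g list \<Rightarrow> 's) \<Rightarrow> 'g monoid \<Rightarrow> ('q, 'g) gsset \<Rightarrow> ('k, 'o, 'v) alg \<Rightarrow> ('g \<Rightarrow> 'v \<Rightarrow> 'v) \<Rightarrow>
   nat \<Rightarrow> nat \<Rightarrow> (nat \<Rightarrow> nat) \<Rightarrow> 'v \<Rightarrow> 'v" where
  "bar_op k Op T Q c G E A \<rho> n m \<alpha> =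
     (THE f. f \<in> alg_hom k Op (bar_ob T Q c G E A m) (bar_ob T Q c G E A n) \<and>
        (\<forall>gs\<in>gtuples G m.
           compose (carrier (bar_ob T Q c G E A 0)) f
             (bar_fibre_tensor T Q c G E A m \<one>\<^bsub>G\<^esub> gs (alg_id (qob Q A))) =
           bar_fibre_tensor T Q c G E A n (gprod G (take (\<alpha> 0) gs)) (bar_pull G n \<alpha> gs)
             (qmor Q A A (\<rho> (gprod G (drop (\<alpha> n) gs))))))"

text \<open>\<open>R\<close>, together with the structure maps \<open>\<iota>\<close>, is a model of the equivariant higher Hochschild
  chains of the simplicial right \<open>G\<close>-set \<open>E\<close> with coefficients in \<open>(A, \<rho>)\<close>. As a colimit it is
  determined up to unique compatible isomorphism.\<close>

definition hochschild_chains ::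
  "'k ring \<Rightarrow> ('k, 'o) operad \<Rightarrow> ((nat \<Rightarrow> nat) \<Rightarrow> 's) \<Rightarrow> ('k, 'o, 'v, 's) tensoring \<Rightarrow>
   ('k, 'o, 'v) replacement \<Rightarrow> ('q \<times> 'g list \<Rightarrow> 's) \<Rightarrow> 'g monoid \<Rightarrow> ('q, 'g) gsset \<Rightarrow>
   ('k, 'o, 'v) alg \<Rightarrow> ('g \<Rightarrow> 'v \<Rightarrow> 'v) \<Rightarrow> ('k, 'o, 'v) alg \<Rightarrow> (nat \<Rightarrow> 'v \<Rightarrow> 'v) \<Rightarrow> bool" where
  "hochschild_chains k Op std T Q c G E A \<rho> R \<iota> \<longleftrightarrow>
     is_realization k Op std T (bar_ob T Q c G E A) (bar_op k Op T Q c G E A \<rho>) R \<iota>"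

text \<open>\<open>f : R \<rightarrow> R'\<close> is the map on Hochschild chains induced by the \<open>G\<close>-equivariant simplicial map
  \<open>\<phi> : E \<rightarrow> E'\<close>.\<close>

definition hochschild_map where
  "hochschild_map std T Q c c' G E E' A \<phi> \<iota> \<iota>' f \<longleftrightarrow>
     (\<forall>m. compose (carrier (tob T (Delta std m) (bar_ob T Q c G E A m))) f (\<iota> m) =
        compose (carrier (tob T (Delta std m) (bar_ob T Q c G E A m))) (\<iota>' m)
          (tmor T (Delta std m) (Delta std m) (sset_id (Delta std m))
             (bar_ob T Q c G E A m) (bar_ob T Q c' G E' A m)
             (tmor T (relabel c (bar_sset G E m)) (relabel c' (bar_sset G E' m))
                (relabel_map c c' (bar_sset G E m) (\<lambda>j (x, gs). (\<phi> j x, gs)))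
                (qob Q A) (qob Q A) (alg_id (qob Q A)))))"


section \<open>Principal bundles with discrete structure group\<close>

subsection \<open>Over topological spaces\<close>

record ('p, 'y, 'g) gbundle =
  tot :: "'p topology"
  proj :: "'p \<Rightarrow> 'y"
  bact :: "'p \<Rightarrow> 'g \<Rightarrow> 'p"

definition principal_bundle :: "'g monoid \<Rightarrow> 'y topology \<Rightarrow> ('p, 'y, 'g) gbundle \<Rightarrow> bool" where
  "principal_bundle G Y P \<longleftrightarrow>
     continuous_map (tot P) Y (proj P) \<and>
     (\<forall>g\<in>carrier G. continuous_map (tot P) (tot P) (\<lambda>x. bact P x g)) \<and>
     (\<forall>x\<in>topspace (tot P). bact P x \<one>\<^bsub>G\<^esub> = x \<and> (\<forall>g\<in>carrier G. proj P (bact P x g) = proj P x \<and>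
        (\<forall>h\<in>carrier G. bact P (bact P x g) h = bact P x (g \<otimes>\<^bsub>G\<^esub> h)))) \<and>
     (\<forall>y\<in>topspace Y. \<exists>U t. openin Y U \<and> y \<in> U \<and>
        homeomorphic_map (prod_topology (subtopology Y U) (discrete_topology (carrier G)))
          (subtopology (tot P) {x \<in> topspace (tot P). proj P x \<in> U}) t \<and>
        (\<forall>u\<in>U. \<forall>g\<in>carrier G. proj P (t (u, g)) = u \<and>
           (\<forall>h\<in>carrier G. bact P (t (u, g)) h = t (u, g \<otimes>\<^bsub>G\<^esub> h))))"

definition pullback_bundle ::
  "'x topology \<Rightarrow> ('x \<Rightarrow> 'y) \<Rightarrow> ('p, 'y, 'g) gbundle \<Rightarrow> ('x \<times> 'p, 'x, 'g) gbundle" where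
  "pullback_bundle X \<Phi> P =
     \<lparr>tot = subtopology (prod_topology X (tot P)) {(x, e). \<Phi> x = proj P e},
      proj = fst, bact = (\<lambda>(x, e) g. (x, bact P e g))\<rparr>"

definition simplex_push :: "nat \<Rightarrow> (nat \<Rightarrow> nat) \<Rightarrow> (nat \<Rightarrow> real) \<Rightarrow> nat \<Rightarrow> real" where
  "simplex_push m \<alpha> t = (\<lambda>j. \<Sum>i | i \<le> m \<and> \<alpha> i = j. t i)"

text \<open>The singular simplicial set of the total space, with the induced right action.\<close>

definition sing_bundle :: "('p, 'y, 'g) gbundle \<Rightarrow> ((nat \<Rightarrow> real) \<Rightarrow> 'p, 'g) gsset" where
  "sing_bundle P =
     \<lparr>simps = (\<lambda>n. singular_simplex_set n (tot P)),
      sop = (\<lambda>m n \<alpha> \<sigma>. \<lambda>t\<in>standard_simplex m. \<sigma> (simplex_push m \<alpha> t)),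
      ract = (\<lambda>n \<sigma> g. \<lambda>t\<in>standard_simplex n. bact P (\<sigma> t) g)\<rparr>"

definition sing_map :: "('p \<Rightarrow> 'q) \<Rightarrow> nat \<Rightarrow> ((nat \<Rightarrow> real) \<Rightarrow> 'p) \<Rightarrow> (nat \<Rightarrow> real) \<Rightarrow> 'q" where
  "sing_map f = (\<lambda>n \<sigma>. \<lambda>t\<in>standard_simplex n. f (\<sigma> t))"

subsection \<open>Over simplicial sets\<close>

definition principal_sbundle ::
  "'g monoid \<Rightarrow> 'y sset \<Rightarrow> ('q, 'g) gsset \<Rightarrow> (nat \<Rightarrow> 'q \<Rightarrow> 'y) \<Rightarrow> bool" where
  "principal_sbundle G Y P \<pi> \<longleftrightarrow> is_gsset G P \<and> \<pi> \<in> sset_hom P Y \<and>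
     (\<forall>n. \<pi> n ` simps P n = simps Y n) \<and>
     (\<forall>n. \<forall>x\<in>simps P n. \<forall>y\<in>simps P n.
        \<pi> n x = \<pi> n y \<longleftrightarrow> (\<exists>g\<in>carrier G. y = ract P n x g)) \<and>
     (\<forall>n. \<forall>x\<in>simps P n. \<forall>g\<in>carrier G. ract P n x g = x \<longrightarrow> g = \<one>\<^bsub>G\<^esub>)"

definition pullback_sbundle ::
  "'x sset \<Rightarrow> (nat \<Rightarrow> 'x \<Rightarrow> 'y) \<Rightarrow> ('q, 'g) gsset \<Rightarrow> (nat \<Rightarrow> 'q \<Rightarrow> 'y) \<Rightarrow> ('x \<times> 'q, 'g) gsset" where
  "pullback_sbundle X \<Phi> P \<pi> =
     \<lparr>simps = (\<lambda>n. {(x, e). x \<in> simps X n \<and> e \<in> simps P n \<and> \<Phi> n x = \<pi> n e}),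
      sop = (\<lambda>m n \<alpha> (x, e). (sop X m n \<alpha> x, sop P m n \<alpha> e)),
      ract = (\<lambda>n (x, e) g. (x, ract P n e g))\<rparr>"

end

theory Submission
  imports Defs
begin

text \<open>For an isomorphism \<open>\<Phi>\<close>, the projection \<open>\<Phi>\<^sup>*P \<rightarrow> P\<close> is an isomorphism of simplicial right
  \<open>G\<close>-sets, so it suffices that the bar construction and its realization are functorial. The
  structure maps of the bar construction are only characterized by their restrictions to the fibres
  \<open>E \<otimes> QA\<close>; that they exist and are natural follows from \<open>(E \<times> G\<^sup>m) \<otimes> QA\<close> being the coproduct of these
  fibres, which is a consequence of the adjunction \<open>Hom(K \<otimes> A, B) \<cong> Hom(K, Map(A, B))\<close>. The
  universal property of the realization then yields mutually inverse maps.\<close>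

section \<open>Morphisms of algebras\<close>

text \<open>The simplices of the two total spaces have different types, whereas the tensoring
  accepts only simplicial sets over one fixed type \<open>'s\<close>. Each total space is therefore
  encoded there by an injection of its own, the two being unrelated, and every comparison map below
  carries a pair of encodings \<open>c\<close>, \<open>c'\<close>. The chains are not a chosen
  object either: \<open>R\<close> and \<open>\<iota>\<close> are arbitrary data with the universal
  property of the coend, so all maps between them have to come from cocones. The delicate point is
  compatibility with the structure maps. On the fibre labelled by a tuple these shift the total
  space by a group element and act on \<open>QA\<close> by another one. A comparison map must hence
  commute with all shifted fibre inclusions, not only with the unshifted ones that characterize the
  structure maps; this is where equivariance enters. Invertibility of \<Phi> enters through the
  inverse e \<mapsto> (\<Phi>^-1(\<pi> e), e) of the projection, with \<pi> the bundle projection of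
  P.\<close>

lemma alg_hom_funcset: "f \<in> alg_hom k Op A B \<Longrightarrow> f \<in> carrier A \<rightarrow> carrier B"
  by (simp add: alg_hom_def dg_map_def linear_map_def)

lemma alg_hom_extensional: "f \<in> alg_hom k Op A B \<Longrightarrow> f \<in> extensional (carrier A)"
  by (simp add: alg_hom_def)

text \<open>Since \<open>compose\<close> restricts to a named domain, rebracketing changes that
  domain from \<open>carrier A\<close> to \<open>carrier B\<close>, which is sound because
  \<open>f\<close> lands in \<open>carrier B\<close>.\<close>

lemma alg_hom_compose_assoc:
  assumes "f \<in> alg_hom k Op A B"
  shows "compose (carrier A) h (compose (carrier A) g f) =
    compose (carrier A) (compose (carrier B) h g) f"
  by (rule compose_assoc) (rule alg_hom_funcset[OF assms])

lemma op_alg_closed: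
  assumes "op_alg k Op A"
  shows "x \<in> carrier A \<Longrightarrow> y \<in> carrier A \<Longrightarrow> x \<oplus>\<^bsub>A\<^esub> y \<in> carrier A"
    and "a \<in> carrier k \<Longrightarrow> x \<in> carrier A \<Longrightarrow> a \<odot>\<^bsub>A\<^esub> x \<in> carrier A"
    and "x \<in> carrier A \<Longrightarrow> dif A x \<in> carrier A"
    and "hdeg A n \<subseteq> carrier A"
    and "set vs \<subseteq> carrier A \<Longrightarrow> o' \<in> carrier (ops Op (length vs)) \<Longrightarrow> act A o' vs \<in> carrier A"
proof -
  have d: "dg_space k A" using assms by (simp add: op_alg_def)
  then have "Module.module k A" by (simp add: dg_space_def)
  then interpret Module.module k A .
  show "x \<in> carrier A \<Longrightarrow> y \<in> carrier A \<Longrightarrow> x \<oplus>\<^bsub>A\<^esub> y \<in> carrier A" by simp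
  show "a \<in> carrier k \<Longrightarrow> x \<in> carrier A \<Longrightarrow> a \<odot>\<^bsub>A\<^esub> x \<in> carrier A" by simp
  show "x \<in> carrier A \<Longrightarrow> dif A x \<in> carrier A"
    using d by (auto simp: dg_space_def linear_map_def)
  show "hdeg A n \<subseteq> carrier A"
    using d submoduleE(1) by (simp add: dg_space_def)
  show "act A o' vs \<in> carrier A"
    if "set vs \<subseteq> carrier A" "o' \<in> carrier (ops Op (length vs))"
  proof -
    have "linear_map k (ops Op (length vs)) A (\<lambda>x. act A x vs)"
      using assms that(1) by (simp add: op_alg_def)
    then show ?thesis using that(2) by (auto simp: linear_map_def)
  qed
qed

text \<open>The closure properties of \<open>A\<close> matter because the composite is restricted to
  \<open>carrier A\<close>: at sums, differentials and results of operations it agrees with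
  \<open>g\<close> after \<open>f\<close> once these elements lie in
  \<open>carrier A\<close>.\<close>

lemma alg_hom_compose:
  assumes A: "op_alg k Op A" and f: "f \<in> alg_hom k Op A B" and g: "g \<in> alg_hom k Op B C"
  shows "compose (carrier A) g f \<in> alg_hom k Op A C"
proof -
  note cl = op_alg_closed[OF A]
  note fc = alg_hom_funcset[OF f] and gc = alg_hom_funcset[OF g]
  have "linear_map k A C (compose (carrier A) g f)"
    using f g cl(1,2) fc gc
    by (auto simp: alg_hom_def dg_map_def linear_map_def compose_eq Pi_iff)
  moreover have "compose (carrier A) g f ` hdeg A n \<subseteq> hdeg C n" for n
  proof -
    have "f ` hdeg A n \<subseteq> hdeg B n" "g ` hdeg B n \<subseteq> hdeg C n"
      using f g by (simp_all add: alg_hom_def dg_map_def)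
    then show ?thesis using cl(4)[of n] by (force simp: compose_eq)
  qed
  moreover have "compose (carrier A) g f (dif A v) = dif C (compose (carrier A) g f v)"
    if "v \<in> carrier A" for v
    using f g that cl(3) fc gc by (auto simp: alg_hom_def dg_map_def compose_eq Pi_iff)
  moreover have "compose (carrier A) g f (act A x vs) = act C x (map (compose (carrier A) g f) vs)"
    if vs: "set vs \<subseteq> carrier A" and x: "x \<in> carrier (ops Op (length vs))" for x vs
  proof -
    have "set (map f vs) \<subseteq> carrier B" using vs fc by auto
    moreover have "map (compose (carrier A) g f) vs = map g (map f vs)"
      using vs by (auto simp: compose_eq)
    ultimately show ?thesis
      using f g vs x cl(5)[OF vs x] by (simp add: alg_hom_def compose_eq del: map_map)
  qed
  ultimately show ?thesis by (simp add: alg_hom_def dg_map_def)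
qed

lemma alg_id_hom:
  assumes A: "op_alg k Op A"
  shows "alg_id A \<in> alg_hom k Op A A"
proof -
  note cl = op_alg_closed[OF A]
  have "map (\<lambda>v\<in>carrier A. v) vs = vs" if "set vs \<subseteq> carrier A" for vs
    using that by (induction vs) auto
  moreover have "(\<lambda>v\<in>carrier A. v) ` hdeg A n \<subseteq> hdeg A n" for n
    using cl(4)[of n] by auto
  ultimately show ?thesis
    using cl unfolding alg_hom_def dg_map_def linear_map_def alg_id_def by simp
qed

lemma alg_id_compose: "f \<in> alg_hom k Op A B \<Longrightarrow> compose (carrier A) (alg_id B) f = f"
  unfolding alg_id_def by (intro Id_compose alg_hom_funcset alg_hom_extensional)

lemma compose_alg_id: "f \<in> alg_hom k Op A B \<Longrightarrow> compose (carrier A) f (alg_id A) = f"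
  unfolding alg_id_def by (rule compose_Id[OF alg_hom_funcset alg_hom_extensional])

section \<open>Simplicial maps and relabelling\<close>

text \<open>In contrast to \<open>sset_hom\<close>, nothing is said about values off the simplices.
  Plain formulas thus qualify, and \<open>relabel_map\<close> makes them extensional.\<close>

definition simplicial_map ::
  "('s, 'x) sset_scheme \<Rightarrow> ('t, 'y) sset_scheme \<Rightarrow> (nat \<Rightarrow> 's \<Rightarrow> 't) \<Rightarrow> bool" where
  "simplicial_map K L \<phi> \<longleftrightarrow> (\<forall>n. \<phi> n \<in> simps K n \<rightarrow> simps L n) \<and>
     (\<forall>m n. \<forall>\<alpha>\<in>ord_maps m n. \<forall>x\<in>simps K n. \<phi> m (sop K m n \<alpha> x) = sop L m n \<alpha> (\<phi> n x))"

lemma is_sset_sop_closed: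
  "is_sset K \<Longrightarrow> \<alpha> \<in> ord_maps m n \<Longrightarrow> x \<in> simps K n \<Longrightarrow> sop K m n \<alpha> x \<in> simps K m"
  unfolding is_sset_def by blast

lemma sset_homD:
  assumes "\<phi> \<in> sset_hom K L"
  shows "x \<in> simps K n \<Longrightarrow> \<phi> n x \<in> simps L n"
    and "\<alpha> \<in> ord_maps m n \<Longrightarrow> x \<in> simps K n \<Longrightarrow> \<phi> m (sop K m n \<alpha> x) = sop L m n \<alpha> (\<phi> n x)"
    and "\<phi> n \<in> extensional (simps K n)"
  using assms by (auto simp: sset_hom_def PiE_iff)

lemma sset_hom_eqI:
  assumes "\<phi> \<in> sset_hom K L" "\<psi> \<in> sset_hom K L'" "\<And>n x. x \<in> simps K n \<Longrightarrow> \<phi> n x = \<psi> n x"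
  shows "\<phi> = \<psi>"
  using assms by (intro ext extensionalityI[OF sset_homD(3) sset_homD(3)]) auto

lemma sset_comp_hom:
  assumes "is_sset K" "\<phi> \<in> sset_hom K L" "\<psi> \<in> sset_hom L M"
  shows "sset_comp K \<psi> \<phi> \<in> sset_hom K M"
  using assms sset_homD[OF assms(2)] sset_homD[OF assms(3)] is_sset_sop_closed[OF assms(1)]
  unfolding sset_hom_def sset_comp_def by (auto simp: compose_def)

lemma sset_id_hom: "is_sset K \<Longrightarrow> sset_id K \<in> sset_hom K K"
  using is_sset_sop_closed[of K] unfolding sset_hom_def sset_id_def by auto

lemma sset_comp_id_left: "\<phi> \<in> sset_hom K L \<Longrightarrow> sset_comp K (sset_id L) \<phi> = \<phi>"
  unfolding sset_comp_def sset_id_def sset_hom_def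
  by (intro ext[of _ \<phi>] Id_compose) (auto simp: PiE_iff)

lemma sset_comp_id_right: "\<phi> \<in> sset_hom K L \<Longrightarrow> sset_comp K \<phi> (sset_id K) = \<phi>"
  unfolding sset_comp_def sset_id_def sset_hom_def
  by (intro ext[of _ \<phi>] compose_Id) (auto simp: PiE_iff)

lemma inv_into_inj: "inj c \<Longrightarrow> x \<in> S \<Longrightarrow> inv_into S c (c x) = x"
  by (meson inj_on_subset inv_into_f_f subset_UNIV)

lemma relabel_simps [simp]: "simps (relabel c K) n = c ` simps K n"
  by (simp add: relabel_def)

lemma relabel_sop [simp]:
  "inj c \<Longrightarrow> x \<in> simps K n \<Longrightarrow> sop (relabel c K) m n \<alpha> (c x) = c (sop K m n \<alpha> x)"
  by (simp add: relabel_def inv_into_inj)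

lemma relabel_map_apply [simp]:
  "inj c \<Longrightarrow> x \<in> simps K n \<Longrightarrow> relabel_map c c' K \<phi> n (c x) = c' (\<phi> n x)"
  by (simp add: relabel_map_def inv_into_inj)

lemma is_sset_relabel:
  assumes "inj c" "is_sset K"
  shows "is_sset (relabel c K)"
proof -
  note cl = is_sset_sop_closed[OF assms(2)]
  show ?thesis
    using assms(2) cl unfolding is_sset_def by (auto simp: assms(1) Pi_iff)
qed

lemma relabel_map_hom:
  assumes "inj c" "inj c'" "is_sset K" "simplicial_map K L \<phi>"
  shows "relabel_map c c' K \<phi> \<in> sset_hom (relabel c K) (relabel c' L)"
proof -
  have "relabel_map c c' K \<phi> n \<in> extensional (c ` simps K n)" for n
    by (simp add: relabel_map_def)
  moreover have "\<phi> n x \<in> simps L n" if "x \<in> simps K n" for n x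
    using assms(4) that by (auto simp: simplicial_map_def)
  ultimately show ?thesis
    using assms(4) is_sset_sop_closed[OF assms(3)]
    unfolding sset_hom_def simplicial_map_def by (auto simp: PiE_iff assms(1,2))
qed

text \<open>Together with \<open>relabel_map_cong\<close> and \<open>relabel_map_id\<close> this
  reduces identities between encoded maps to pointwise computations before encoding. Off the encoded
  simplices both sides are \<open>undefined\<close>.\<close>

lemma relabel_map_comp:
  assumes "inj c" "inj c'" "simplicial_map K L \<phi>"
  shows "sset_comp (relabel c K) (relabel_map c' c'' L \<psi>) (relabel_map c c' K \<phi>) =
    relabel_map c c'' K (\<lambda>n x. \<psi> n (\<phi> n x))"
proof (intro ext)
  fix n s
  show "sset_comp (relabel c K) (relabel_map c' c'' L \<psi>) (relabel_map c c' K \<phi>) n s =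
    relabel_map c c'' K (\<lambda>n x. \<psi> n (\<phi> n x)) n s"
  proof (cases "s \<in> c ` simps K n")
    case True
    moreover have "\<phi> n x \<in> simps L n" if "x \<in> simps K n" for x
      using assms(3) that by (auto simp: simplicial_map_def)
    ultimately show ?thesis by (auto simp: sset_comp_def compose_eq assms(1,2))
  next
    case False
    then show ?thesis by (simp add: sset_comp_def relabel_map_def compose_def)
  qed
qed

lemma relabel_map_cong:
  assumes "inj c" "\<And>n x. x \<in> simps K n \<Longrightarrow> \<phi> n x = \<psi> n x"
  shows "relabel_map c c' K \<phi> = relabel_map c c' K \<psi>"
  using assms(2) by (auto simp: fun_eq_iff relabel_map_def inv_into_inj[OF assms(1)])

lemma relabel_map_id:
  assumes "inj c" "\<And>n x. x \<in> simps K n \<Longrightarrow> \<phi> n x = x"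
  shows "relabel_map c c K \<phi> = sset_id (relabel c K)"
  using assms(2) by (auto simp: fun_eq_iff relabel_map_def sset_id_def inv_into_inj[OF assms(1)])

section \<open>Standard simplices and the Yoneda maps of simplices\<close>

lemma ord_maps_comp:
  "\<alpha> \<in> ord_maps l m \<Longrightarrow> \<beta> \<in> ord_maps m n \<Longrightarrow> compose {..l} \<beta> \<alpha> \<in> ord_maps l n"
  by (auto simp: ord_maps_def PiE_iff compose_eq intro!: mono_onI dest: mono_onD)

lemma is_sset_simplex: "is_sset (simplex n)"
proof -
  have 1: "compose {..m} x (\<lambda>j\<in>{..m}. j) = x" if "x \<in> ord_maps m n" for m x
    using that by (intro compose_Id) (auto simp: ord_maps_def PiE_iff)
  have 2: "compose {..l} x (compose {..l} \<beta> \<alpha>) = compose {..l} (compose {..m} x \<beta>) \<alpha>"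
    if "\<alpha> \<in> ord_maps l m" for l m and \<alpha> \<beta> x :: "nat \<Rightarrow> nat"
    using that by (intro compose_assoc) (auto simp: ord_maps_def PiE_iff)
  show ?thesis
    unfolding is_sset_def simplex_def using 1 2 ord_maps_comp by auto
qed

lemma is_sset_Delta: "inj std \<Longrightarrow> is_sset (Delta std n)"
  unfolding Delta_def by (intro is_sset_relabel is_sset_simplex)

lemma Delta_map_hom:
  assumes "inj std" "\<alpha> \<in> ord_maps m n"
  shows "Delta_map std m n \<alpha> \<in> sset_hom (Delta std m) (Delta std n)"
proof -
  have "compose {..l} \<alpha> (compose {..l} x \<beta>) = compose {..l} (compose {..p} \<alpha> x) \<beta>"
    if "\<beta> \<in> ord_maps l p" for l p \<beta> and x :: "nat \<Rightarrow> nat"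
    using that by (intro compose_assoc) (auto simp: ord_maps_def PiE_iff)
  then have "simplicial_map (simplex m) (simplex n) (\<lambda>l \<beta>. compose {..l} \<alpha> \<beta>)"
    using ord_maps_comp assms(2) by (auto simp: simplicial_map_def simplex_def)
  then show ?thesis
    unfolding Delta_def Delta_map_def using assms by (intro relabel_map_hom is_sset_simplex)
qed

text \<open>This is the Yoneda map of \<open>x\<close>, simplicial by functoriality of
  \<open>K\<close>. Its target is \<open>K\<close> itself and not a relabelled copy, so the values
  on encoded simplices are computed by hand instead of through
  \<open>relabel_map_hom\<close>.\<close>

lemma classify_hom:
  assumes "inj std" "is_sset K" "x \<in> simps K n"
  shows "classify std K n x \<in> sset_hom (Delta std n) K"
proof -
  have ext: "classify std K n x m \<in> extensional (std ` ord_maps m n)" for m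
    by (simp add: classify_def relabel_map_def simplex_def)
  have val: "classify std K n x m (std \<beta>) = sop K m n \<beta> x" if "\<beta> \<in> ord_maps m n" for m \<beta>
    using that assms(1) by (simp add: classify_def simplex_def)
  have sop: "sop (Delta std n) l m \<alpha> (std \<beta>) = std (compose {..l} \<beta> \<alpha>)"
    if "\<beta> \<in> ord_maps m n" for l m \<alpha> \<beta>
    using that assms(1) by (simp add: Delta_def simplex_def)
  have simps: "simps (Delta std n) m = std ` ord_maps m n" for m
    by (simp add: Delta_def simplex_def)
  have comp: "sop K l n (compose {..l} \<beta> \<alpha>) x = sop K l m \<alpha> (sop K m n \<beta> x)"
    if "\<alpha> \<in> ord_maps l m" "\<beta> \<in> ord_maps m n" for l m \<alpha> \<beta>
    using that assms(2,3) unfolding is_sset_def by blast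
  have "classify std K n x m \<in> std ` ord_maps m n \<rightarrow>\<^sub>E simps K m" for m
    using ext val is_sset_sop_closed[OF assms(2) _ assms(3)] by (auto simp: PiE_iff)
  moreover have "classify std K n x l (sop (Delta std n) l m \<alpha> s) =
      sop K l m \<alpha> (classify std K n x m s)"
    if "\<alpha> \<in> ord_maps l m" "s \<in> std ` ord_maps m n" for l m \<alpha> s
    using that by (auto simp: sop val ord_maps_comp comp)
  ultimately show ?thesis by (simp add: sset_hom_def simps)
qed

text \<open>Naturality in the Yoneda lemma: at \<beta> both sides are the image of \<open>x\<close>
  under \<phi>, restricted along \<beta>, because \<phi> commutes with the simplicial
  operators.\<close>

lemma classify_natural:
  assumes "inj std" "is_sset K" "is_sset L" "\<phi> \<in> sset_hom K L" "x \<in> simps K n"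
  shows "sset_comp (Delta std n) \<phi> (classify std K n x) = classify std L n (\<phi> n x)"
proof (rule sset_hom_eqI)
  show "sset_comp (Delta std n) \<phi> (classify std K n x) \<in> sset_hom (Delta std n) L"
    by (rule sset_comp_hom[OF is_sset_Delta classify_hom]) fact+
  show "classify std L n (\<phi> n x) \<in> sset_hom (Delta std n) L"
    by (rule classify_hom) (fact | rule sset_homD(1)[OF assms(4,5)])+
  show "sset_comp (Delta std n) \<phi> (classify std K n x) m s = classify std L n (\<phi> n x) m s"
    if "s \<in> simps (Delta std n) m" for m s
    using that sset_homD(2)[OF assms(4) _ assms(5)] assms(1)
    by (auto simp: Delta_def sset_comp_def compose_eq classify_def simplex_def)
qed

section \<open>Tensors as coproducts\<close>

locale algebra_tensoring =
  fixes k :: "'k ring" and Op :: "('k, 'o) operad" and std :: "(nat \<Rightarrow> nat) \<Rightarrow> 's"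
    and T :: "('k, 'o, 'v, 's) tensoring"
  assumes inj_std: "inj std" and tensoring: "is_tensoring k Op std T"
begin

lemma op_alg_tob: "is_sset K \<Longrightarrow> op_alg k Op A \<Longrightarrow> op_alg k Op (tob T K A)"
  using tensoring unfolding is_tensoring_def by simp

lemma tmor_id:
  "is_sset K \<Longrightarrow> op_alg k Op A \<Longrightarrow> tmor T K K (sset_id K) A A (alg_id A) = alg_id (tob T K A)"
  using tensoring unfolding is_tensoring_def by simp

lemma tmor_hom:
  "is_sset K \<Longrightarrow> is_sset L \<Longrightarrow> op_alg k Op A \<Longrightarrow> op_alg k Op B \<Longrightarrow>
    \<phi> \<in> sset_hom K L \<Longrightarrow> f \<in> alg_hom k Op A B \<Longrightarrow>
    tmor T K L \<phi> A B f \<in> alg_hom k Op (tob T K A) (tob T L B)"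
  using tensoring unfolding is_tensoring_def by simp

lemma tmor_comp:
  "is_sset K \<Longrightarrow> is_sset L \<Longrightarrow> is_sset M \<Longrightarrow>
    op_alg k Op A \<Longrightarrow> op_alg k Op B \<Longrightarrow> op_alg k Op C \<Longrightarrow>
    \<phi> \<in> sset_hom K L \<Longrightarrow> \<psi> \<in> sset_hom L M \<Longrightarrow> f \<in> alg_hom k Op A B \<Longrightarrow> g \<in> alg_hom k Op B C \<Longrightarrow>
    compose (carrier (tob T K A)) (tmor T L M \<psi> B C g) (tmor T K L \<phi> A B f) =
    tmor T K M (sset_comp K \<psi> \<phi>) A C (compose (carrier A) g f)"
  using tensoring unfolding is_tensoring_def by simp

section \<open>Transposition between maps out of a tensor and maps into a mapping space\<close>

definition adjunct where
  "adjunct K A f = (\<lambda>n. \<lambda>x\<in>simps K n. compose (carrier (tob T (Delta std n) A)) f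
     (tmor T (Delta std n) K (classify std K n x) A A (alg_id A)))"

lemma bij_adjunct:
  "is_sset K \<Longrightarrow> op_alg k Op A \<Longrightarrow> op_alg k Op B \<Longrightarrow>
    bij_betw (adjunct K A) (alg_hom k Op (tob T K A) B) (sset_hom K (map_space k Op std T A B))"
  using tensoring unfolding is_tensoring_def adjunct_def[abs_def] by blast

text \<open>Functoriality of the tensoring fuses \<phi> \<otimes> A with the tensored Yoneda map of
  \<open>x\<close>, and the result is the tensored Yoneda map of the simplex \<phi> x. Restricting
  along \<phi> before transposing is thus precomposing the transpose with \<phi>.\<close>

lemma adjunct_natural:
  assumes K: "is_sset K" and L: "is_sset L" and A: "op_alg k Op A"
    and \<phi>: "\<phi> \<in> sset_hom K L" and x: "x \<in> simps K n"
  shows "adjunct K A (compose (carrier (tob T K A)) f (tmor T K L \<phi> A A (alg_id A))) n x =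
    adjunct L A f n (\<phi> n x)"
proof -
  note D = is_sset_Delta[OF inj_std, of n] and cl = classify_hom[OF inj_std K x]
  note idA = alg_id_hom[OF A]
  have "compose (carrier (tob T (Delta std n) A)) (tmor T K L \<phi> A A (alg_id A))
      (tmor T (Delta std n) K (classify std K n x) A A (alg_id A)) =
    tmor T (Delta std n) L (classify std L n (\<phi> n x)) A A (alg_id A)"
    using tmor_comp[OF D K L A A A cl \<phi> idA idA] classify_natural[OF inj_std K L \<phi> x]
      alg_id_compose[OF idA] by simp
  then show ?thesis
    using x sset_homD(1)[OF \<phi> x]
    by (simp add: adjunct_def alg_hom_compose_assoc[OF tmor_hom[OF D K A A cl idA], symmetric])
qed

text \<open>Maps out of K \<otimes> A are simplicial maps from K to the mapping space, and those can
  be glued uniquely when every simplex of K lies in exactly one of the copies \<open>j i\<close> of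
  L. The summands are all modelled on the same L, which is the case of a discrete factor.\<close>

lemma tensor_coproduct:
  assumes K: "is_sset K" and L: "is_sset L" and A: "op_alg k Op A" and B: "op_alg k Op B"
    and j: "\<And>i. i \<in> I \<Longrightarrow> j i \<in> sset_hom L K"
    and decomp: "\<And>n x. x \<in> simps K n \<Longrightarrow> \<exists>!(i, y). i \<in> I \<and> y \<in> simps L n \<and> x = j i n y"
    and h: "\<And>i. i \<in> I \<Longrightarrow> h i \<in> alg_hom k Op (tob T L A) B"
  shows "\<exists>!f. f \<in> alg_hom k Op (tob T K A) B \<and>
    (\<forall>i\<in>I. compose (carrier (tob T L A)) f (tmor T L K (j i) A A (alg_id A)) = h i)"
proof -
  note bijK = bij_adjunct[OF K A B] and bijL = bij_adjunct[OF L A B]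
  note idA = alg_id_hom[OF A]
  let ?M = "map_space k Op std T A B"
  let ?res = "\<lambda>i f. compose (carrier (tob T L A)) f (tmor T L K (j i) A A (alg_id A))"
  have res: "?res i f \<in> alg_hom k Op (tob T L A) B"
    if "i \<in> I" "f \<in> alg_hom k Op (tob T K A) B" for i f
    using that(2) by (rule alg_hom_compose[OF op_alg_tob[OF L A] tmor_hom[OF L K A A j[OF that(1)] idA]])
  have nat: "adjunct L A (?res i f) n y = adjunct K A f n (j i n y)"
    if "i \<in> I" "y \<in> simps L n" for i n y and f :: "'v \<Rightarrow> 'v"
    using adjunct_natural[OF L K A j] that by blast
  have adj_hom: "adjunct L A (h i) \<in> sset_hom L ?M" if "i \<in> I" for i
    using bij_betwE[OF bijL] h that by blast
  \<comment> \<open>\<open>ix\<close> reads off the summand of a simplex and its coordinate there;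
    \<open>u\<close> is the simplicial map glued from the transposes of the
    \<open>h i\<close>.\<close>
  define ix where "ix n x = (THE (i, y). i \<in> I \<and> y \<in> simps L n \<and> x = j i n y)" for n x
  have ix: "ix n (j i n y) = (i, y)" if "i \<in> I" "y \<in> simps L n" for n i y
  proof -
    have "j i n y \<in> simps K n" using sset_homD(1)[OF j] that by blast
    from decomp[OF this] show ?thesis
      unfolding ix_def by (rule the1_equality) (use that in simp)
  qed
  define u where "u n = (\<lambda>x\<in>simps K n. adjunct L A (h (fst (ix n x))) n (snd (ix n x)))" for n
  have decomp': "\<exists>i y. i \<in> I \<and> y \<in> simps L n \<and> x = j i n y" if "x \<in> simps K n" for n x
    using decomp[OF that] by (auto elim!: ex1E)
  have u: "u n (j i n y) = adjunct L A (h i) n y" if "i \<in> I" "y \<in> simps L n" for n i y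
    using that sset_homD(1)[OF j] ix by (simp add: u_def)
  have u_hom: "u \<in> sset_hom K ?M"
  proof -
    have "u n x \<in> simps ?M n" if "x \<in> simps K n" for n x
      using decomp'[OF that] u sset_homD(1)[OF adj_hom] by auto
    \<comment> \<open>Each \<open>j i\<close> is simplicial, so the operators never leave a summand
      and the claim reduces to the transpose of a single \<open>h i\<close>.\<close>
    moreover have "u m (sop K m n \<alpha> x) = sop ?M m n \<alpha> (u n x)"
      if \<alpha>: "\<alpha> \<in> ord_maps m n" and x: "x \<in> simps K n" for m n \<alpha> x
    proof -
      obtain i y where i: "i \<in> I" and y: "y \<in> simps L n" and x': "x = j i n y"
        using decomp'[OF x] by blast
      have "u m (sop K m n \<alpha> x) = u m (j i m (sop L m n \<alpha> y))"
        using sset_homD(2)[OF j[OF i] \<alpha> y] x' by simp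
      also have "\<dots> = adjunct L A (h i) m (sop L m n \<alpha> y)"
        using u i is_sset_sop_closed[OF L \<alpha> y] by simp
      also have "\<dots> = sop ?M m n \<alpha> (u n x)"
        using sset_homD(2)[OF adj_hom[OF i] \<alpha> y] u[OF i y] x' by simp
      finally show ?thesis .
    qed
    ultimately show ?thesis by (auto simp: sset_hom_def PiE_iff u_def)
  qed
  obtain f where f: "f \<in> alg_hom k Op (tob T K A) B" and fu: "adjunct K A f = u"
    using u_hom[folded bij_betw_imp_surj_on[OF bijK]] by blast
  \<comment> \<open>Prescribing all restrictions amounts to prescribing the transpose. Existence and
    uniqueness of \<open>f\<close> are then surjectivity and injectivity of transposition over
    K.\<close>
  have eq: "f' \<in> alg_hom k Op (tob T K A) B \<Longrightarrow>
      (\<forall>i\<in>I. ?res i f' = h i) \<longleftrightarrow> adjunct K A f' = u" for f'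
  proof
    assume f': "f' \<in> alg_hom k Op (tob T K A) B" and "\<forall>i\<in>I. ?res i f' = h i"
    then have "adjunct K A f' n x = u n x" if "x \<in> simps K n" for n x
      using decomp'[OF that] nat u by metis
    then show "adjunct K A f' = u"
      using sset_hom_eqI bij_betwE[OF bijK] f' u_hom by blast
  next
    assume f': "f' \<in> alg_hom k Op (tob T K A) B" and eq: "adjunct K A f' = u"
    show "\<forall>i\<in>I. ?res i f' = h i"
    proof
      fix i assume i: "i \<in> I"
      have "adjunct L A (?res i f') n y = adjunct L A (h i) n y" if "y \<in> simps L n" for n y
        using nat[OF i that] u[OF i that] eq by simp
      then have "adjunct L A (?res i f') = adjunct L A (h i)"
        using sset_hom_eqI bij_betwE[OF bijL] res[OF i f'] h[OF i] by blast
      \<comment> \<open>Injectivity of transposition over L leads back from transposes to algebra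
        maps.\<close>
      then show "?res i f' = h i"
        using inj_onD[OF bij_betw_imp_inj_on[OF bijL]] res[OF i f'] h[OF i] by blast
    qed
  qed
  show ?thesis
  proof (rule ex1I[of _ f])
    show "f \<in> alg_hom k Op (tob T K A) B \<and> (\<forall>i\<in>I. ?res i f = h i)"
      using f fu eq by blast
    show "f' = f" if "f' \<in> alg_hom k Op (tob T K A) B \<and> (\<forall>i\<in>I. ?res i f' = h i)" for f'
      using that eq f fu inj_onD[OF bij_betw_imp_inj_on[OF bijK]] by blast
  qed
qed

section \<open>Tensoring algebra maps with a fixed standard simplex\<close>

definition simplex_lift where
  "simplex_lift m A B f = tmor T (Delta std m) (Delta std m) (sset_id (Delta std m)) A B f"

lemma simplex_lift_hom:
  "op_alg k Op A \<Longrightarrow> op_alg k Op B \<Longrightarrow> f \<in> alg_hom k Op A B \<Longrightarrow>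
    simplex_lift m A B f \<in> alg_hom k Op (tob T (Delta std m) A) (tob T (Delta std m) B)"
  unfolding simplex_lift_def by (intro tmor_hom is_sset_Delta inj_std sset_id_hom)

lemma simplex_lift_id:
  "op_alg k Op A \<Longrightarrow> simplex_lift m A A (alg_id A) = alg_id (tob T (Delta std m) A)"
  unfolding simplex_lift_def by (intro tmor_id is_sset_Delta inj_std)

lemma simplex_lift_comp:
  assumes "op_alg k Op A" "op_alg k Op B" "op_alg k Op C"
    and "f \<in> alg_hom k Op A B" "g \<in> alg_hom k Op B C"
  shows "compose (carrier (tob T (Delta std m) A)) (simplex_lift m B C g) (simplex_lift m A B f) =
    simplex_lift m A C (compose (carrier A) g f)"
proof -
  note D = is_sset_Delta[OF inj_std, of m]
  show ?thesis
    using tmor_comp[OF D D D assms(1-3) sset_id_hom[OF D] sset_id_hom[OF D] assms(4,5)]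
      sset_comp_id_left[OF sset_id_hom[OF D]]
    by (simp add: simplex_lift_def)
qed

text \<open>The interchange law of a functor of two variables: both composites are the tensor of
  \<open>Delta_map\<close> with \<open>f\<close>.\<close>

lemma simplex_lift_Delta_map:
  assumes A: "op_alg k Op A" and B: "op_alg k Op B" and f: "f \<in> alg_hom k Op A B"
    and \<alpha>: "\<alpha> \<in> ord_maps m n"
  shows "compose (carrier (tob T (Delta std m) A))
      (tmor T (Delta std m) (Delta std n) (Delta_map std m n \<alpha>) B B (alg_id B)) (simplex_lift m A B f) =
    compose (carrier (tob T (Delta std m) A)) (simplex_lift n A B f)
      (tmor T (Delta std m) (Delta std n) (Delta_map std m n \<alpha>) A A (alg_id A))"
proof -
  note D = is_sset_Delta[OF inj_std]
  note h = Delta_map_hom[OF inj_std \<alpha>]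
  show ?thesis
    unfolding simplex_lift_def
      tmor_comp[OF D D D A B B sset_id_hom[OF D] h f alg_id_hom[OF B]]
      tmor_comp[OF D D D A A B h sset_id_hom[OF D] alg_id_hom[OF A] f]
      sset_comp_id_left[OF h] sset_comp_id_right[OF h] alg_id_compose[OF f] compose_alg_id[OF f] ..
qed

end

section \<open>Naturality of the bar construction\<close>

lemma gtuples_take: "gs \<in> gtuples G m \<Longrightarrow> set (take i gs) \<subseteq> carrier G"
  unfolding gtuples_def using set_take_subset by fastforce

lemma gtuples_drop: "gs \<in> gtuples G m \<Longrightarrow> set (drop i gs) \<subseteq> carrier G"
  unfolding gtuples_def using set_drop_subset by fastforce

lemma gprod_closed:
  assumes "monoid G"
  shows "set gs \<subseteq> carrier G \<Longrightarrow> gprod G gs \<in> carrier G"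
proof -
  interpret monoid G by fact
  show "set gs \<subseteq> carrier G \<Longrightarrow> gprod G gs \<in> carrier G"
    by (induction gs) (auto simp: gprod_def)
qed

lemma bar_pull_gtuples:
  assumes "monoid G" "gs \<in> gtuples G m"
  shows "bar_pull G n \<alpha> gs \<in> gtuples G n"
proof -
  have "set (drop i (take j gs)) \<subseteq> carrier G" for i j
    using gtuples_take[OF assms(2), of j] set_drop_subset[of i "take j gs"] by blast
  then show ?thesis
    using gprod_closed[OF assms(1)] by (auto simp: gtuples_def bar_pull_def)
qed

lemma is_gssetD:
  assumes "is_gsset G E"
  shows "is_sset E"
    and "x \<in> simps E n \<Longrightarrow> ract E n x \<one>\<^bsub>G\<^esub> = x"
    and "x \<in> simps E n \<Longrightarrow> g \<in> carrier G \<Longrightarrow> ract E n x g \<in> simps E n"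
    and "\<alpha> \<in> ord_maps m n \<Longrightarrow> x \<in> simps E n \<Longrightarrow> g \<in> carrier G \<Longrightarrow>
      sop E m n \<alpha> (ract E n x g) = ract E m (sop E m n \<alpha> x) g"
  using assms unfolding is_gsset_def by blast+

lemma is_sset_bar_sset:
  assumes "is_sset E"
  shows "is_sset (bar_sset G E m)"
proof -
  have "sop E l n (compose {..l} \<beta> \<alpha>) x = sop E l m \<alpha> (sop E m n \<beta> x)"
    if "\<alpha> \<in> ord_maps l m" "\<beta> \<in> ord_maps m n" "x \<in> simps E n" for l m n \<alpha> \<beta> x
    using assms that unfolding is_sset_def by blast
  moreover have "sop E n n (\<lambda>j\<in>{..n}. j) x = x" if "x \<in> simps E n" for n x
    using assms that unfolding is_sset_def by blast
  ultimately show ?thesis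
    using is_sset_sop_closed[OF assms] unfolding is_sset_def[of "bar_sset G E m"]
    by (auto simp: bar_sset_def)
qed

lemma simplicial_map_bar_fibre:
  assumes "is_gsset G E" "g \<in> carrier G" "gs \<in> gtuples G m"
  shows "simplicial_map (bar_sset G E 0) (bar_sset G E m) (bar_fibre E g gs)"
  using is_gssetD[OF assms(1)] assms(2,3)
  by (auto simp: simplicial_map_def bar_sset_def bar_fibre_def)

definition gsset_map ::
  "'g monoid \<Rightarrow> ('p, 'g) gsset \<Rightarrow> ('q, 'g) gsset \<Rightarrow> (nat \<Rightarrow> 'p \<Rightarrow> 'q) \<Rightarrow> bool" where
  "gsset_map G E E' \<phi> \<longleftrightarrow> simplicial_map E E' \<phi> \<and>
     (\<forall>n. \<forall>x\<in>simps E n. \<forall>g\<in>carrier G. \<phi> n (ract E n x g) = ract E' n (\<phi> n x) g)"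

lemma gsset_mapD:
  assumes "gsset_map G E E' \<phi>"
  shows "x \<in> simps E n \<Longrightarrow> \<phi> n x \<in> simps E' n"
    and "\<alpha> \<in> ord_maps m n \<Longrightarrow> x \<in> simps E n \<Longrightarrow> \<phi> m (sop E m n \<alpha> x) = sop E' m n \<alpha> (\<phi> n x)"
    and "x \<in> simps E n \<Longrightarrow> g \<in> carrier G \<Longrightarrow> \<phi> n (ract E n x g) = ract E' n (\<phi> n x) g"
  using assms unfolding gsset_map_def simplicial_map_def by (auto simp: Pi_iff)

lemma simplicial_map_bar_sset:
  assumes "gsset_map G E E' \<phi>"
  shows "simplicial_map (bar_sset G E m) (bar_sset G E' m) (\<lambda>j (x, gs). (\<phi> j x, gs))"
  using gsset_mapD[OF assms] by (auto simp: simplicial_map_def bar_sset_def)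

section \<open>The bar construction as a coproduct over G^m, and its structure maps\<close>

locale hochschild = algebra_tensoring k Op std T
  for k :: "'k ring" and Op :: "('k, 'o) operad" and std :: "(nat \<Rightarrow> nat) \<Rightarrow> 's"
    and T :: "('k, 'o, 'v, 's) tensoring" +
  fixes Q :: "('k, 'o, 'v) replacement" and G :: "'g monoid"
    and A :: "('k, 'o, 'v) alg" and \<rho> :: "'g \<Rightarrow> 'v \<Rightarrow> 'v"
  assumes replacement: "cofibrant_replacement k Op Q" and group: "group G"
    and equivariant: "equivariant_alg k Op G A \<rho>"
begin

abbreviation "QA \<equiv> qob Q A"

lemma monoid: "monoid G"
  using group by (rule group.is_monoid)

lemma op_alg_A: "op_alg k Op A"
  using equivariant by (simp add: equivariant_alg_def)

lemma op_alg_QA: "op_alg k Op QA"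
  using replacement op_alg_A by (simp add: cofibrant_replacement_def cofibrant_def)

lemma qmor_hom: "g \<in> carrier G \<Longrightarrow> qmor Q A A (\<rho> g) \<in> alg_hom k Op QA QA"
  using replacement op_alg_A equivariant
  by (simp add: cofibrant_replacement_def equivariant_alg_def)

lemmas id_QA = alg_id_hom[OF op_alg_QA]

lemma is_sset_bar:
  "inj c \<Longrightarrow> is_gsset G E \<Longrightarrow> is_sset (relabel c (bar_sset G E m))"
  by (intro is_sset_relabel is_sset_bar_sset is_gssetD(1))

lemma op_alg_bar_ob: "inj c \<Longrightarrow> is_gsset G E \<Longrightarrow> op_alg k Op (bar_ob T Q c G E A m)"
  unfolding bar_ob_def by (intro op_alg_tob is_sset_bar op_alg_QA)

lemma bar_fibre_hom:
  assumes "inj c" "is_gsset G E" "g \<in> carrier G" "gs \<in> gtuples G m"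
  shows "relabel_map c c (bar_sset G E 0) (bar_fibre E g gs) \<in>
    sset_hom (relabel c (bar_sset G E 0)) (relabel c (bar_sset G E m))"
  using assms by (intro relabel_map_hom is_sset_bar_sset is_gssetD(1) simplicial_map_bar_fibre)

lemma bar_fibre_tensor_hom:
  assumes "inj c" "is_gsset G E" "g \<in> carrier G" "gs \<in> gtuples G m" "q \<in> alg_hom k Op QA QA"
  shows "bar_fibre_tensor T Q c G E A m g gs q \<in>
    alg_hom k Op (bar_ob T Q c G E A 0) (bar_ob T Q c G E A m)"
  unfolding bar_fibre_tensor_def bar_ob_def
  using assms by (intro tmor_hom is_sset_bar op_alg_QA bar_fibre_hom)

text \<open>The simplices of E \<times> G^m are partitioned by their tuple, and the fibre inclusion
  shifted by \<one> is the copy of E carrying that label. Existence yields the structure maps,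
  uniqueness the test for equality of maps on fibres.\<close>

lemma bar_coproduct:
  assumes c: "inj c" and E: "is_gsset G E" and B: "op_alg k Op B"
    and h: "\<And>gs. gs \<in> gtuples G m \<Longrightarrow> h gs \<in> alg_hom k Op (bar_ob T Q c G E A 0) B"
  shows "\<exists>!f. f \<in> alg_hom k Op (bar_ob T Q c G E A m) B \<and>
    (\<forall>gs\<in>gtuples G m. compose (carrier (bar_ob T Q c G E A 0)) f
       (bar_fibre_tensor T Q c G E A m \<one>\<^bsub>G\<^esub> gs (alg_id QA)) = h gs)"
proof -
  have one: "\<one>\<^bsub>G\<^esub> \<in> carrier G" by (rule monoid.one_closed[OF monoid])
  have "\<exists>!(gs, y). gs \<in> gtuples G m \<and> y \<in> simps (relabel c (bar_sset G E 0)) n \<and>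
      x = relabel_map c c (bar_sset G E 0) (bar_fibre E \<one>\<^bsub>G\<^esub> gs) n y"
    if x: "x \<in> simps (relabel c (bar_sset G E m)) n" for n x
  proof -
    obtain e gs where e: "e \<in> simps E n" and gs: "gs \<in> gtuples G m" and x: "x = c (e, gs)"
      using x by (auto simp: bar_sset_def)
    \<comment> \<open>The only tuple of length 0 is \<open>[]\<close>, so the summand E appears as E
      \<times> G^0 with simplices \<open>(e, [])\<close>.\<close>
    have simps0: "simps (bar_sset G E 0) n = simps E n \<times> {[]}"
      by (auto simp: bar_sset_def gtuples_def)
    have val: "relabel_map c c (bar_sset G E 0) (bar_fibre E \<one>\<^bsub>G\<^esub> gs') n (c (e', [])) = c (e', gs')"
      if "e' \<in> simps E n" for e' gs'
      using that is_gssetD(2)[OF E] by (simp add: c bar_fibre_def simps0)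
    show ?thesis
    proof (rule ex1I[of _ "(gs, c (e, []))"])
      show "case (gs, c (e, [])) of (gs, y) \<Rightarrow> gs \<in> gtuples G m \<and>
          y \<in> simps (relabel c (bar_sset G E 0)) n \<and>
          x = relabel_map c c (bar_sset G E 0) (bar_fibre E \<one>\<^bsub>G\<^esub> gs) n y"
        using e gs val by (simp add: simps0 x)
      show "p = (gs, c (e, []))" if p: "case p of (gs, y) \<Rightarrow> gs \<in> gtuples G m \<and>
          y \<in> simps (relabel c (bar_sset G E 0)) n \<and>
          x = relabel_map c c (bar_sset G E 0) (bar_fibre E \<one>\<^bsub>G\<^esub> gs) n y" for p
      proof -
        obtain gs' e' where p': "p = (gs', c (e', []))" and e': "e' \<in> simps E n"
          and "x = relabel_map c c (bar_sset G E 0) (bar_fibre E \<one>\<^bsub>G\<^esub> gs') n (c (e', []))"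
          using p by (auto simp: simps0)
        then have "c (e, gs) = c (e', gs')" using val x by simp
        then show ?thesis using injD[OF c] p' by blast
      qed
    qed
  qed
  from tensor_coproduct[where h = h and I = "gtuples G m",
      OF is_sset_bar[OF c E] is_sset_bar[OF c E] op_alg_QA B bar_fibre_hom[OF c E one] this]
  show ?thesis
    using h unfolding bar_fibre_tensor_def bar_ob_def by simp
qed

lemma bar_hom_eqI:
  assumes c: "inj c" and E: "is_gsset G E" and B: "op_alg k Op B"
    and f: "f \<in> alg_hom k Op (bar_ob T Q c G E A m) B"
    and f': "f' \<in> alg_hom k Op (bar_ob T Q c G E A m) B"
    and eq: "\<And>gs. gs \<in> gtuples G m \<Longrightarrow>
      compose (carrier (bar_ob T Q c G E A 0)) f
       (bar_fibre_tensor T Q c G E A m \<one>\<^bsub>G\<^esub> gs (alg_id QA)) =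
      compose (carrier (bar_ob T Q c G E A 0)) f'
       (bar_fibre_tensor T Q c G E A m \<one>\<^bsub>G\<^esub> gs (alg_id QA))"
  shows "f = f'"
proof -
  \<comment> \<open>The restrictions of \<open>f\<close> themselves serve as the prescribed family,
    which \<open>f'\<close> realizes as well by \<open>eq\<close>.\<close>
  let ?h = "\<lambda>gs. compose (carrier (bar_ob T Q c G E A 0)) f
      (bar_fibre_tensor T Q c G E A m \<one>\<^bsub>G\<^esub> gs (alg_id QA))"
  have "?h gs \<in> alg_hom k Op (bar_ob T Q c G E A 0) B" if "gs \<in> gtuples G m" for gs
    using f by (rule alg_hom_compose[OF op_alg_bar_ob[OF c E]
        bar_fibre_tensor_hom[OF c E monoid.one_closed[OF monoid] that id_QA]])
  then have "\<exists>!g. g \<in> alg_hom k Op (bar_ob T Q c G E A m) B \<and>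
    (\<forall>gs\<in>gtuples G m. compose (carrier (bar_ob T Q c G E A 0)) g
       (bar_fibre_tensor T Q c G E A m \<one>\<^bsub>G\<^esub> gs (alg_id QA)) = ?h gs)"
    by (rule bar_coproduct[OF c E B])
  then show ?thesis
    unfolding ex1_iff_ex_Uniq by (elim conjE, elim Uniq_D) (use f f' eq in simp_all)
qed

text \<open>The definite description defining \<open>bar_op\<close> is meaningful because its
  clauses prescribe one algebra map on each summand of a coproduct. These two facts are all that is
  used about it afterwards.\<close>

lemma bar_op:
  assumes c: "inj c" and E: "is_gsset G E"
  shows bar_op_hom: "bar_op k Op T Q c G E A \<rho> n m \<alpha> \<in>
      alg_hom k Op (bar_ob T Q c G E A m) (bar_ob T Q c G E A n)"
    and bar_op_fibre: "gs \<in> gtuples G m \<Longrightarrow>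
      compose (carrier (bar_ob T Q c G E A 0)) (bar_op k Op T Q c G E A \<rho> n m \<alpha>)
        (bar_fibre_tensor T Q c G E A m \<one>\<^bsub>G\<^esub> gs (alg_id QA)) =
      bar_fibre_tensor T Q c G E A n (gprod G (take (\<alpha> 0) gs)) (bar_pull G n \<alpha> gs)
        (qmor Q A A (\<rho> (gprod G (drop (\<alpha> n) gs))))"
proof -
  let ?h = "\<lambda>gs. bar_fibre_tensor T Q c G E A n (gprod G (take (\<alpha> 0) gs)) (bar_pull G n \<alpha> gs)
      (qmor Q A A (\<rho> (gprod G (drop (\<alpha> n) gs))))"
  have "?h gs \<in> alg_hom k Op (bar_ob T Q c G E A 0) (bar_ob T Q c G E A n)" if "gs \<in> gtuples G m" for gs
    by (intro bar_fibre_tensor_hom[OF c E] qmor_hom gprod_closed[OF monoid]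
        bar_pull_gtuples[OF monoid that] gtuples_take[OF that] gtuples_drop[OF that])
  from theI'[OF bar_coproduct[where h = ?h, OF c E op_alg_bar_ob[OF c E] this]]
  show "bar_op k Op T Q c G E A \<rho> n m \<alpha> \<in>
      alg_hom k Op (bar_ob T Q c G E A m) (bar_ob T Q c G E A n)"
    and "gs \<in> gtuples G m \<Longrightarrow>
      compose (carrier (bar_ob T Q c G E A 0)) (bar_op k Op T Q c G E A \<rho> n m \<alpha>)
        (bar_fibre_tensor T Q c G E A m \<one>\<^bsub>G\<^esub> gs (alg_id QA)) =
      bar_fibre_tensor T Q c G E A n (gprod G (take (\<alpha> 0) gs)) (bar_pull G n \<alpha> gs)
        (qmor Q A A (\<rho> (gprod G (drop (\<alpha> n) gs))))"
    unfolding bar_op_def by simp_all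
qed

section \<open>Maps of bar constructions induced by equivariant simplicial maps\<close>

definition bar_map where
  "bar_map c c' E E' \<phi> m =
     tmor T (relabel c (bar_sset G E m)) (relabel c' (bar_sset G E' m))
       (relabel_map c c' (bar_sset G E m) (\<lambda>j (x, gs). (\<phi> j x, gs))) QA QA (alg_id QA)"

lemma bar_map_hom_sset:
  assumes "inj c" "inj c'" "is_gsset G E" "gsset_map G E E' \<phi>"
  shows "relabel_map c c' (bar_sset G E m) (\<lambda>j (x, gs). (\<phi> j x, gs)) \<in>
    sset_hom (relabel c (bar_sset G E m)) (relabel c' (bar_sset G E' m))"
  using assms by (intro relabel_map_hom is_sset_bar_sset is_gssetD(1) simplicial_map_bar_sset)

lemma bar_map_hom:
  assumes "inj c" "inj c'" "is_gsset G E" "is_gsset G E'" "gsset_map G E E' \<phi>"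
  shows "bar_map c c' E E' \<phi> m \<in> alg_hom k Op (bar_ob T Q c G E A m) (bar_ob T Q c' G E' A m)"
  unfolding bar_map_def bar_ob_def
  using assms by (intro tmor_hom is_sset_bar op_alg_QA bar_map_hom_sset id_QA)

text \<open>Functoriality of the tensoring. Stated for one composite, it gives the other one by
  exchanging the roles of E and E'.\<close>

lemma bar_map_inverse:
  assumes c: "inj c" "inj c'" and E: "is_gsset G E" "is_gsset G E'"
    and \<phi>: "gsset_map G E E' \<phi>" and \<psi>: "gsset_map G E' E \<psi>"
    and inverse: "\<And>n x. x \<in> simps E n \<Longrightarrow> \<psi> n (\<phi> n x) = x"
  shows "compose (carrier (bar_ob T Q c G E A m)) (bar_map c' c E' E \<psi> m) (bar_map c c' E E' \<phi> m) =
    alg_id (bar_ob T Q c G E A m)"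
proof -
  have "relabel_map c c (bar_sset G E m)
      (\<lambda>n x. (\<lambda>(x, gs). (\<psi> n x, gs)) ((\<lambda>(x, gs). (\<phi> n x, gs)) x)) = sset_id (relabel c (bar_sset G E m))"
    by (rule relabel_map_id[OF c(1)]) (auto simp: bar_sset_def inverse)
  then show ?thesis
    unfolding bar_map_def bar_ob_def
    by (simp add: tmor_comp[OF is_sset_bar[OF c(1) E(1)] is_sset_bar[OF c(2) E(2)]
          is_sset_bar[OF c(1) E(1)] op_alg_QA op_alg_QA op_alg_QA bar_map_hom_sset[OF c E(1) \<phi>]
          bar_map_hom_sset[OF c(2,1) E(2) \<psi>] id_QA id_QA]
        relabel_map_comp[OF c simplicial_map_bar_sset[OF \<phi>]] alg_id_compose[OF id_QA]
        tmor_id[OF is_sset_bar[OF c(1) E(1)] op_alg_QA])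
qed

text \<open>Equivariance: \<phi>(x g) = \<phi>(x) g. General \<open>g\<close> and \<open>q\<close>
  are needed because a structure map carries an unshifted fibre to a shifted one and acts on
  \<open>QA\<close> at the same time.\<close>

lemma bar_map_fibre:
  assumes c: "inj c" "inj c'" and E: "is_gsset G E" "is_gsset G E'" and \<phi>: "gsset_map G E E' \<phi>"
    and g: "g \<in> carrier G" and gs: "gs \<in> gtuples G m" and q: "q \<in> alg_hom k Op QA QA"
  shows "compose (carrier (bar_ob T Q c G E A 0)) (bar_map c c' E E' \<phi> m)
      (bar_fibre_tensor T Q c G E A m g gs q) =
    compose (carrier (bar_ob T Q c G E A 0)) (bar_fibre_tensor T Q c' G E' A m g gs q)
      (bar_map c c' E E' \<phi> 0)"
proof -
  note bar = is_sset_bar[OF c(1) E(1)] and bar' = is_sset_bar[OF c(2) E(2)]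
  have "relabel_map c c' (bar_sset G E 0)
      (\<lambda>n x. (\<lambda>(x, gs). (\<phi> n x, gs)) (bar_fibre E g gs n x)) =
    relabel_map c c' (bar_sset G E 0)
      (\<lambda>n x. bar_fibre E' g gs n ((\<lambda>(x, gs). (\<phi> n x, gs)) x))"
    by (rule relabel_map_cong[OF c(1)])
      (use gsset_mapD(3)[OF \<phi> _ g] in \<open>auto simp: bar_sset_def bar_fibre_def\<close>)
  then show ?thesis
    unfolding bar_map_def bar_ob_def bar_fibre_tensor_def
    by (simp add: alg_id_compose[OF q] compose_alg_id[OF q]
        tmor_comp[OF bar bar bar' op_alg_QA op_alg_QA op_alg_QA bar_fibre_hom[OF c(1) E(1) g gs]
          bar_map_hom_sset[OF c E(1) \<phi>] q id_QA]
        tmor_comp[OF bar bar' bar' op_alg_QA op_alg_QA op_alg_QA bar_map_hom_sset[OF c E(1) \<phi>]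
          bar_fibre_hom[OF c(2) E(2) g gs] id_QA q]
        relabel_map_comp[OF c simplicial_map_bar_sset[OF \<phi>]]
        relabel_map_comp[OF c(1) c(1) simplicial_map_bar_fibre[OF E(1) g gs]])
qed

text \<open>Structure maps are known only on fibres, so both sides are compared there. Each turns
  into the shifted fibre inclusion for E' after the map induced on E \<times> G^0.\<close>

lemma bar_map_bar_op:
  assumes c: "inj c" "inj c'" and E: "is_gsset G E" "is_gsset G E'" and \<phi>: "gsset_map G E E' \<phi>"
  shows "compose (carrier (bar_ob T Q c G E A m)) (bar_map c c' E E' \<phi> n)
      (bar_op k Op T Q c G E A \<rho> n m \<alpha>) =
    compose (carrier (bar_ob T Q c G E A m)) (bar_op k Op T Q c' G E' A \<rho> n m \<alpha>)
      (bar_map c c' E E' \<phi> m)" (is "?l = ?r")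
proof (rule bar_hom_eqI[OF c(1) E(1)])
  note ob = op_alg_bar_ob[OF c(1) E(1)] and one = monoid.one_closed[OF monoid]
  note op = bar_op_hom[OF c(1) E(1)] and op' = bar_op_hom[OF c(2) E(2)]
  note map = bar_map_hom[OF c E \<phi>]
  show "op_alg k Op (bar_ob T Q c' G E' A n)" by (rule op_alg_bar_ob[OF c(2) E(2)])
  show "?l \<in> alg_hom k Op (bar_ob T Q c G E A m) (bar_ob T Q c' G E' A n)"
    by (rule alg_hom_compose[OF ob op map])
  show "?r \<in> alg_hom k Op (bar_ob T Q c G E A m) (bar_ob T Q c' G E' A n)"
    by (rule alg_hom_compose[OF ob map op'])
  fix gs assume gs: "gs \<in> gtuples G m"
  let ?B = "carrier (bar_ob T Q c G E A 0)"
  let ?fib = "bar_fibre_tensor T Q c G E A m \<one>\<^bsub>G\<^esub> gs (alg_id QA)"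
  let ?op = "bar_op k Op T Q c G E A \<rho> n m \<alpha>"
  let ?op' = "bar_op k Op T Q c' G E' A \<rho> n m \<alpha>"
  note fib = bar_fibre_tensor_hom[OF c(1) E(1) one gs id_QA]
  have "compose ?B ?l ?fib = compose ?B (bar_map c c' E E' \<phi> n) (compose ?B ?op ?fib)"
    by (rule alg_hom_compose_assoc[OF fib, symmetric])
  also have "\<dots> = compose ?B (bar_fibre_tensor T Q c' G E' A n (gprod G (take (\<alpha> 0) gs))
      (bar_pull G n \<alpha> gs) (qmor Q A A (\<rho> (gprod G (drop (\<alpha> n) gs))))) (bar_map c c' E E' \<phi> 0)"
    unfolding bar_op_fibre[OF c(1) E(1) gs]
    by (intro bar_map_fibre[OF c E \<phi>] qmor_hom gprod_closed[OF monoid]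
        bar_pull_gtuples[OF monoid gs] gtuples_take[OF gs] gtuples_drop[OF gs])
  \<comment> \<open>The shift, the tuple and the group element acting on \<open>QA\<close> depend on
    \<open>gs\<close> and \<alpha> alone. Hence \<open>bar_op_fibre\<close> for E', read backwards,
    brings in the structure map of the other side.\<close>
  also have "\<dots> = compose ?B (compose (carrier (bar_ob T Q c' G E' A 0)) ?op'
      (bar_fibre_tensor T Q c' G E' A m \<one>\<^bsub>G\<^esub> gs (alg_id QA))) (bar_map c c' E E' \<phi> 0)"
    unfolding bar_op_fibre[OF c(2) E(2) gs] ..
  also have "\<dots> = compose ?B ?op' (compose ?B
      (bar_fibre_tensor T Q c' G E' A m \<one>\<^bsub>G\<^esub> gs (alg_id QA)) (bar_map c c' E E' \<phi> 0))"
    by (rule alg_hom_compose_assoc[OF map, symmetric])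
  also have "\<dots> = compose ?B ?op' (compose ?B (bar_map c c' E E' \<phi> m) ?fib)"
    unfolding bar_map_fibre[OF c E \<phi> one gs id_QA] ..
  also have "\<dots> = compose ?B ?r ?fib"
    by (rule alg_hom_compose_assoc[OF fib])
  finally show "compose ?B ?l ?fib = compose ?B ?r ?fib" .
qed

section \<open>Induced maps between realizations\<close>

abbreviation lifted_bar_map where
  "lifted_bar_map c c' E E' \<phi> m \<equiv>
     simplex_lift m (bar_ob T Q c G E A m) (bar_ob T Q c' G E' A m) (bar_map c c' E E' \<phi> m)"

text \<open>A map of simplicial objects turns cocones under its target into cocones under its
  source. Applied to the cocone of the second realization, it supplies the input for the universal
  property of the first.\<close>

lemma dinatural_pull_back:
  assumes c: "inj c" "inj c'" and E: "is_gsset G E" "is_gsset G E'" and \<phi>: "gsset_map G E E' \<phi>"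
    and \<kappa>: "dinatural k Op std T (bar_ob T Q c' G E' A) (bar_op k Op T Q c' G E' A \<rho>) S \<kappa>"
  shows "dinatural k Op std T (bar_ob T Q c G E A) (bar_op k Op T Q c G E A \<rho>) S
    (\<lambda>m. compose (carrier (tob T (Delta std m) (bar_ob T Q c G E A m))) (\<kappa> m)
       (lifted_bar_map c c' E E' \<phi> m))"
proof -
  let ?B = "bar_ob T Q c G E A" and ?B' = "bar_ob T Q c' G E' A"
  let ?op = "bar_op k Op T Q c G E A \<rho>" and ?op' = "bar_op k Op T Q c' G E' A \<rho>"
  let ?\<theta> = "bar_map c c' E E' \<phi>"
  let ?C = "\<lambda>m n. carrier (tob T (Delta std m) (?B n))"
  let ?shift = "\<lambda>m n \<alpha> X. tmor T (Delta std m) (Delta std n) (Delta_map std m n \<alpha>) X X (alg_id X)"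
  note ob = op_alg_bar_ob[OF c(1) E(1)] and ob' = op_alg_bar_ob[OF c(2) E(2)]
  note op = bar_op_hom[OF c(1) E(1)] and op' = bar_op_hom[OF c(2) E(2)]
  note \<theta> = bar_map_hom[OF c E \<phi>]
  note D = is_sset_Delta[OF inj_std]
  note lift = simplex_lift_hom[OF ob ob' \<theta>]
  have S: "op_alg k Op S" and \<kappa>_hom: "\<And>m. \<kappa> m \<in> alg_hom k Op (tob T (Delta std m) (?B' m)) S"
    and \<kappa>_eq: "\<And>m n \<alpha>. \<alpha> \<in> ord_maps m n \<Longrightarrow>
      compose (carrier (tob T (Delta std m) (?B' n))) (\<kappa> m)
        (simplex_lift m (?B' n) (?B' m) (?op' m n \<alpha>)) =
      compose (carrier (tob T (Delta std m) (?B' n))) (\<kappa> n) (?shift m n \<alpha> (?B' n))"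
    using \<kappa> unfolding dinatural_def simplex_lift_def by blast+
  have "compose (?C m n) (compose (?C m m) (\<kappa> m) (simplex_lift m (?B m) (?B' m) (?\<theta> m)))
      (simplex_lift m (?B n) (?B m) (?op m n \<alpha>)) =
    compose (?C m n) (compose (?C n n) (\<kappa> n) (simplex_lift n (?B n) (?B' n) (?\<theta> n)))
      (?shift m n \<alpha> (?B n))" (is "?l = ?r") if \<alpha>: "\<alpha> \<in> ord_maps m n" for m n \<alpha>
  proof -
    note shift = tmor_hom[OF D D ob ob Delta_map_hom[OF inj_std \<alpha>] alg_id_hom[OF ob]]
    have "?l = compose (?C m n) (\<kappa> m) (compose (?C m n) (simplex_lift m (?B m) (?B' m) (?\<theta> m))
        (simplex_lift m (?B n) (?B m) (?op m n \<alpha>)))"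
      by (rule alg_hom_compose_assoc[OF simplex_lift_hom[OF ob ob op], symmetric])
    \<comment> \<open>Naturality with respect to the structure maps, tensored with \<Delta>^m: the
      comparison map moves from degree m to degree n.\<close>
    also have "\<dots> = compose (?C m n) (\<kappa> m) (compose (?C m n)
        (simplex_lift m (?B' n) (?B' m) (?op' m n \<alpha>)) (simplex_lift m (?B n) (?B' n) (?\<theta> n)))"
      unfolding simplex_lift_comp[OF ob ob ob' op \<theta>] simplex_lift_comp[OF ob ob' ob' \<theta> op']
        bar_map_bar_op[OF c E \<phi>] ..
    \<comment> \<open>Rebracketed so that the left factor, with domain \<Delta>^m \<otimes> B'_n, is
      one side of the dinaturality of \<kappa>.\<close>
    also have "\<dots> = compose (?C m n) (compose (carrier (tob T (Delta std m) (?B' n))) (\<kappa> m)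
        (simplex_lift m (?B' n) (?B' m) (?op' m n \<alpha>))) (simplex_lift m (?B n) (?B' n) (?\<theta> n))"
      by (rule alg_hom_compose_assoc[OF lift])
    also have "\<dots> = compose (?C m n) (\<kappa> n) (compose (?C m n) (?shift m n \<alpha> (?B' n))
        (simplex_lift m (?B n) (?B' n) (?\<theta> n)))"
      unfolding \<kappa>_eq[OF \<alpha>] by (rule alg_hom_compose_assoc[OF lift, symmetric])
    also have "\<dots> = compose (?C m n) (\<kappa> n) (compose (?C m n)
        (simplex_lift n (?B n) (?B' n) (?\<theta> n)) (?shift m n \<alpha> (?B n)))"
      unfolding simplex_lift_Delta_map[OF ob ob' \<theta> \<alpha>] ..
    also have "\<dots> = ?r"
      by (rule alg_hom_compose_assoc[OF shift])
    finally show ?thesis .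
  qed
  then show ?thesis
    unfolding dinatural_def using S alg_hom_compose[OF op_alg_tob[OF D ob] lift \<kappa>_hom]
    by (simp add: simplex_lift_def)
qed

text \<open>Both the composite and the identity are endomorphisms of \<open>R\<close> compatible
  with \<open>\<iota>\<close>; the universal property of \<open>R\<close> against its own cocone
  admits only one. Exchanging the two sides yields the other composite.\<close>

lemma hochschild_chains_inverse:
  assumes c: "inj c" "inj c'" and E: "is_gsset G E" "is_gsset G E'"
    and \<phi>: "gsset_map G E E' \<phi>" and \<psi>: "gsset_map G E' E \<psi>"
    and inverse: "\<And>n x. x \<in> simps E n \<Longrightarrow> \<psi> n (\<phi> n x) = x"
    and R: "hochschild_chains k Op std T Q c G E A \<rho> R \<iota>"
    and f: "f \<in> alg_hom k Op R R'" and g: "g \<in> alg_hom k Op R' R"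
    and f_map: "hochschild_map std T Q c c' G E E' A \<phi> \<iota> \<iota>' f"
    and g_map: "hochschild_map std T Q c' c G E' E A \<psi> \<iota>' \<iota> g"
    and \<iota>': "\<And>m. \<iota>' m \<in> alg_hom k Op (tob T (Delta std m) (bar_ob T Q c' G E' A m)) R'"
  shows "compose (carrier R) g f = alg_id R"
proof -
  let ?B = "bar_ob T Q c G E A" and ?B' = "bar_ob T Q c' G E' A"
  let ?C = "\<lambda>m. carrier (tob T (Delta std m) (?B m))"
  let ?C' = "\<lambda>m. carrier (tob T (Delta std m) (?B' m))"
  let ?\<theta> = "lifted_bar_map c c' E E' \<phi>" and ?\<theta>' = "lifted_bar_map c' c E' E \<psi>"
  note ob = op_alg_bar_ob[OF c(1) E(1)] and ob' = op_alg_bar_ob[OF c(2) E(2)]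
  note map = bar_map_hom[OF c E \<phi>] and map' = bar_map_hom[OF c(2,1) E(2,1) \<psi>]
  note lift = simplex_lift_hom[OF ob ob' map]
  have din: "dinatural k Op std T ?B (bar_op k Op T Q c G E A \<rho>) R \<iota>"
    and univ: "\<exists>!f. f \<in> alg_hom k Op R R \<and> (\<forall>m. compose (?C m) f (\<iota> m) = \<iota> m)"
    using R unfolding hochschild_chains_def is_realization_def by blast+
  have opR: "op_alg k Op R" and \<iota>: "\<And>m. \<iota> m \<in> alg_hom k Op (tob T (Delta std m) (?B m)) R"
    using din unfolding dinatural_def by blast+
  have f_eq: "compose (?C m) f (\<iota> m) = compose (?C m) (\<iota>' m) (?\<theta> m)"
    and g_eq: "compose (?C' m) g (\<iota>' m) = compose (?C' m) (\<iota> m) (?\<theta>' m)" for m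
    using f_map g_map unfolding hochschild_map_def simplex_lift_def bar_map_def by blast+
  have inv: "compose (carrier (?B m)) (bar_map c' c E' E \<psi> m) (bar_map c c' E E' \<phi> m) =
      alg_id (?B m)" for m
    by (rule bar_map_inverse[OF c E \<phi> \<psi> inverse])
  have "compose (?C m) (compose (carrier R) g f) (\<iota> m) = \<iota> m" for m
  proof -
    have "compose (?C m) (compose (carrier R) g f) (\<iota> m) = compose (?C m) g (compose (?C m) (\<iota>' m) (?\<theta> m))"
      unfolding alg_hom_compose_assoc[OF \<iota>, symmetric] f_eq ..
    \<comment> \<open>Here \<open>g\<close> is absorbed by the second cocone, leaving the lifts of
      \<psi> and \<phi> next to each other, where they cancel.\<close>
    also have "\<dots> = compose (?C m) (compose (?C' m) (\<iota> m) (?\<theta>' m)) (?\<theta> m)"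
      unfolding alg_hom_compose_assoc[OF lift] g_eq ..
    also have "\<dots> = compose (?C m) (\<iota> m) (alg_id (tob T (Delta std m) (?B m)))"
      unfolding alg_hom_compose_assoc[OF lift, symmetric] simplex_lift_comp[OF ob ob' ob map map']
        inv simplex_lift_id[OF ob] ..
    also have "\<dots> = \<iota> m"
      by (rule compose_alg_id[OF \<iota>])
    finally show ?thesis .
  qed
  moreover have "compose (carrier R) g f \<in> alg_hom k Op R R"
    by (rule alg_hom_compose[OF opR f g])
  moreover have "compose (?C m) (alg_id R) (\<iota> m) = \<iota> m" for m
    by (rule alg_id_compose[OF \<iota>])
  ultimately show ?thesis
    using univ alg_id_hom[OF opR] unfolding ex1_iff_ex_Uniq
    by (elim conjE, elim Uniq_D) simp_all
qed

lemma hochschild_map_exists: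
  assumes c: "inj c" "inj c'" and E: "is_gsset G E" "is_gsset G E'" and \<phi>: "gsset_map G E E' \<phi>"
    and R: "hochschild_chains k Op std T Q c G E A \<rho> R \<iota>"
    and R': "hochschild_chains k Op std T Q c' G E' A \<rho> R' \<iota>'"
  shows "\<exists>f\<in>alg_hom k Op R R'. hochschild_map std T Q c c' G E E' A \<phi> \<iota> \<iota>' f"
proof -
  let ?B = "bar_ob T Q c G E A"
  let ?C = "\<lambda>m. carrier (tob T (Delta std m) (?B m))"
  have "dinatural k Op std T ?B (bar_op k Op T Q c G E A \<rho>) R'
      (\<lambda>m. compose (?C m) (\<iota>' m) (lifted_bar_map c c' E E' \<phi> m))"
    by (rule dinatural_pull_back[OF c E \<phi>])
      (use R' in \<open>simp add: hochschild_chains_def is_realization_def\<close>)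
  with R obtain f where "f \<in> alg_hom k Op R R'"
    and "\<forall>m. compose (?C m) f (\<iota> m) = compose (?C m) (\<iota>' m) (lifted_bar_map c c' E E' \<phi> m)"
    unfolding hochschild_chains_def is_realization_def by blast
  then show ?thesis
    unfolding hochschild_map_def simplex_lift_def bar_map_def by blast
qed

lemma hochschild_chains_iso:
  assumes c: "inj c" "inj c'" and E: "is_gsset G E" "is_gsset G E'"
    and \<phi>: "gsset_map G E E' \<phi>" and bij: "\<And>n. bij_betw (\<phi> n) (simps E n) (simps E' n)"
    and R: "hochschild_chains k Op std T Q c G E A \<rho> R \<iota>"
    and R': "hochschild_chains k Op std T Q c' G E' A \<rho> R' \<iota>'"
  shows "\<exists>f\<in>alg_iso k Op R R'. hochschild_map std T Q c c' G E E' A \<phi> \<iota> \<iota>' f"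
proof -
  \<comment> \<open>The inverse is taken degree by degree. That it commutes with operators and
    action follows from the corresponding law for \<phi> at \<open>\<psi> n y\<close>, followed by
    cancelling \<phi>.\<close>
  define \<psi> where "\<psi> n = inv_into (simps E n) (\<phi> n)" for n
  have \<psi>\<phi>: "\<psi> n (\<phi> n x) = x" if "x \<in> simps E n" for n x
    unfolding \<psi>_def by (rule bij_betw_inv_into_left[OF bij that])
  have \<phi>\<psi>: "\<phi> n (\<psi> n y) = y" and \<psi>_in: "\<psi> n y \<in> simps E n" if "y \<in> simps E' n" for n y
    using bij_betw_inv_into_right[OF bij that] bij_betwE[OF bij_betw_inv_into[OF bij]] that
    by (auto simp: \<psi>_def)
  have "\<psi> m (sop E' m n \<alpha> y) = sop E m n \<alpha> (\<psi> n y)"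
    if \<alpha>: "\<alpha> \<in> ord_maps m n" and y: "y \<in> simps E' n" for m n \<alpha> y
    using gsset_mapD(2)[OF \<phi> \<alpha> \<psi>_in[OF y]] \<phi>\<psi>[OF y]
      \<psi>\<phi>[OF is_sset_sop_closed[OF is_gssetD(1)[OF E(1)] \<alpha> \<psi>_in[OF y]]] by simp
  moreover have "\<psi> n (ract E' n y g) = ract E n (\<psi> n y) g"
    if y: "y \<in> simps E' n" and g: "g \<in> carrier G" for n y g
    using gsset_mapD(3)[OF \<phi> \<psi>_in[OF y] g] \<phi>\<psi>[OF y]
      \<psi>\<phi>[OF is_gssetD(3)[OF E(1) \<psi>_in[OF y] g]] by simp
  ultimately have \<psi>: "gsset_map G E' E \<psi>"
    using \<psi>_in by (simp add: gsset_map_def simplicial_map_def)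
  obtain f where f: "f \<in> alg_hom k Op R R'"
    and f_map: "hochschild_map std T Q c c' G E E' A \<phi> \<iota> \<iota>' f"
    using hochschild_map_exists[OF c E \<phi> R R'] by blast
  obtain g where g: "g \<in> alg_hom k Op R' R"
    and g_map: "hochschild_map std T Q c' c G E' E A \<psi> \<iota>' \<iota> g"
    using hochschild_map_exists[OF c(2,1) E(2,1) \<psi> R' R] by blast
  have \<iota>: "\<iota> m \<in> alg_hom k Op (tob T (Delta std m) (bar_ob T Q c G E A m)) R"
    and \<iota>': "\<iota>' m \<in> alg_hom k Op (tob T (Delta std m) (bar_ob T Q c' G E' A m)) R'" for m
    using R R' unfolding hochschild_chains_def is_realization_def dinatural_def by blast+
  have "compose (carrier R) g f = alg_id R"
    by (rule hochschild_chains_inverse[OF c E \<phi> \<psi> \<psi>\<phi> R f g f_map g_map \<iota>'])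
  moreover have "compose (carrier R') f g = alg_id R'"
    by (rule hochschild_chains_inverse[OF c(2,1) E(2,1) \<psi> \<phi> \<phi>\<psi> R' g f g_map f_map \<iota>])
  ultimately show ?thesis
    using f g f_map by (auto simp: alg_iso_def)
qed

end

section \<open>Pullbacks along isomorphisms\<close>

lemma simplex_push_id:
  assumes "t \<in> standard_simplex n"
  shows "simplex_push n (\<lambda>j\<in>{..n}. j) t = t"
proof
  fix j
  \<comment> \<open>For j > n the sum is empty, in accordance with points of the n-simplex having
    vanishing coordinates beyond n.\<close>
  have "{i. i \<le> n \<and> (\<lambda>j\<in>{..n}. j) i = j} = (if j \<le> n then {j} else {})" by auto
  then show "simplex_push n (\<lambda>j\<in>{..n}. j) t j = t j"
    using assms by (simp add: simplex_push_def standard_simplex_def)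
qed

lemma simplex_push_comp:
  assumes \<alpha>: "\<alpha> \<in> ord_maps l m"
  shows "simplex_push m \<beta> (simplex_push l \<alpha> t) = simplex_push l (compose {..l} \<beta> \<alpha>) t"
proof
  fix j
  have eq: "{p. p \<le> l \<and> compose {..l} \<beta> \<alpha> p = j} = {p. p \<le> l \<and> \<beta> (\<alpha> p) = j}"
    by (auto simp: compose_eq)
  \<comment> \<open>The vertices p sent to j by the composite are grouped by their intermediate
    vertex \<alpha> p, which is at most m.\<close>
  have "(\<Sum>i | i \<le> m \<and> \<beta> i = j. \<Sum>p | p \<in> {p. p \<le> l \<and> \<beta> (\<alpha> p) = j} \<and> \<alpha> p = i. t p) =
      (\<Sum>p | p \<le> l \<and> \<beta> (\<alpha> p) = j. t p)"
    using \<alpha> by (intro sum.group) (auto simp: ord_maps_def PiE_iff)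
  moreover have "(\<Sum>i | i \<le> m \<and> \<beta> i = j. \<Sum>p | p \<in> {p. p \<le> l \<and> \<beta> (\<alpha> p) = j} \<and> \<alpha> p = i. t p) =
      (\<Sum>i | i \<le> m \<and> \<beta> i = j. \<Sum>p | p \<le> l \<and> \<alpha> p = i. t p)"
    by (intro sum.cong) auto
  ultimately show "simplex_push m \<beta> (simplex_push l \<alpha> t) j = simplex_push l (compose {..l} \<beta> \<alpha>) t j"
    by (simp add: simplex_push_def eq)
qed

lemma simplex_push_in:
  assumes \<alpha>: "\<alpha> \<in> ord_maps m n" and t: "t \<in> standard_simplex m"
  shows "simplex_push m \<alpha> t \<in> standard_simplex n"
proof -
  have nonneg: "\<And>i. 0 \<le> t i" and total: "(\<Sum>i\<le>m. t i) = 1"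
    using t by (auto simp: standard_simplex_def)
  \<comment> \<open>The bound by 1 is part of the definition of \<open>standard_simplex\<close>; a
    coordinate of the image is a partial sum of nonnegative terms with total 1.\<close>
  have "simplex_push m \<alpha> t j \<le> 1" for j
    unfolding simplex_push_def total[symmetric] by (intro sum_mono2) (auto simp: nonneg)
  moreover have "0 \<le> simplex_push m \<alpha> t j" for j
    unfolding simplex_push_def by (intro sum_nonneg) (simp add: nonneg)
  moreover have "simplex_push m \<alpha> t j = 0" if "j > n" for j
  proof -
    have "\<alpha> i \<le> n" if "i \<le> m" for i
      using \<alpha> that by (simp add: ord_maps_def PiE_iff)
    then have "{i. i \<le> m \<and> \<alpha> i = j} = {}" using \<open>j > n\<close> by (auto simp: not_le[symmetric])
    then show ?thesis by (simp only: simplex_push_def sum.empty)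
  qed
  \<comment> \<open>The fibres of \<alpha> partition the vertices of the m-simplex.\<close>
  moreover have "(\<Sum>j\<le>n. simplex_push m \<alpha> t j) = 1"
  proof -
    have "(\<Sum>j\<le>n. simplex_push m \<alpha> t j) = (\<Sum>j\<le>n. \<Sum>i | i \<in> {..m} \<and> \<alpha> i = j. t i)"
      by (simp add: simplex_push_def)
    also have "\<dots> = (\<Sum>i\<le>m. t i)"
      using \<alpha> by (intro sum.group) (auto simp: ord_maps_def PiE_iff)
    finally show ?thesis using total by simp
  qed
  ultimately show ?thesis by (simp add: standard_simplex_def)
qed

lemma continuous_map_simplex_push:
  assumes "\<alpha> \<in> ord_maps m n"
  shows "continuous_map (subtopology (powertop_real UNIV) (standard_simplex m))
    (subtopology (powertop_real UNIV) (standard_simplex n)) (simplex_push m \<alpha>)"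
proof -
  have "continuous_map (powertop_real UNIV) euclideanreal (\<lambda>t. simplex_push m \<alpha> t j)" for j
    unfolding simplex_push_def
    by (intro continuous_map_sum continuous_map_product_projection) auto
  then have "continuous_map (powertop_real UNIV) (powertop_real UNIV) (simplex_push m \<alpha>)"
    by (simp add: continuous_map_componentwise_UNIV)
  then show ?thesis
    using simplex_push_in[OF assms]
    by (auto simp: continuous_map_in_subtopology intro: continuous_map_from_subtopology)
qed

section \<open>Singular simplices and the singular simplicial G-set\<close>

lemma singular_simplexD:
  assumes "\<sigma> \<in> singular_simplex_set n X"
  shows "continuous_map (subtopology (powertop_real UNIV) (standard_simplex n)) X \<sigma>"
    and "\<sigma> \<in> extensional (standard_simplex n)"
    and "t \<in> standard_simplex n \<Longrightarrow> \<sigma> t \<in> topspace X"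
proof -
  show cont: "continuous_map (subtopology (powertop_real UNIV) (standard_simplex n)) X \<sigma>"
    and "\<sigma> \<in> extensional (standard_simplex n)"
    using assms by (simp_all add: singular_simplex_def)
  show "t \<in> standard_simplex n \<Longrightarrow> \<sigma> t \<in> topspace X"
    using funcset_mem[OF continuous_map_funspace[OF cont]] by simp
qed

lemma singular_simplexI:
  assumes "continuous_map (subtopology (powertop_real UNIV) (standard_simplex n)) X f"
  shows "(\<lambda>t\<in>standard_simplex n. f t) \<in> singular_simplex_set n X"
  using assms by (simp add: singular_simplex_def continuous_map_eq)

lemma singular_simplex_map:
  assumes "\<sigma> \<in> singular_simplex_set n X" "continuous_map X Y f"
  shows "(\<lambda>t\<in>standard_simplex n. f (\<sigma> t)) \<in> singular_simplex_set n Y"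
  using continuous_map_compose[OF singular_simplexD(1)[OF assms(1)] assms(2)]
  by (intro singular_simplexI) (simp add: comp_def)

lemma singular_simplex_push:
  assumes "\<sigma> \<in> singular_simplex_set n X" "\<alpha> \<in> ord_maps m n"
  shows "(\<lambda>t\<in>standard_simplex m. \<sigma> (simplex_push m \<alpha> t)) \<in> singular_simplex_set m X"
  using continuous_map_compose[OF continuous_map_simplex_push[OF assms(2)] singular_simplexD(1)[OF assms(1)]]
  by (intro singular_simplexI) (simp add: comp_def)

text \<open>Phrased through the action on the total space alone, so that it covers a bundle and its
  pullback alike. Continuity is asked of each group element separately, as G is discrete.\<close>

lemma is_gsset_sing_bundle:
  fixes P :: "('p, 'y, 'g) gbundle"
  assumes cont: "\<And>g. g \<in> carrier G \<Longrightarrow> continuous_map (tot P) (tot P) (\<lambda>x. bact P x g)"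
    and one: "\<And>x. x \<in> topspace (tot P) \<Longrightarrow> bact P x \<one>\<^bsub>G\<^esub> = x"
    and assoc: "\<And>x g h. x \<in> topspace (tot P) \<Longrightarrow> g \<in> carrier G \<Longrightarrow> h \<in> carrier G \<Longrightarrow>
      bact P (bact P x g) h = bact P x (g \<otimes>\<^bsub>G\<^esub> h)"
  shows "is_gsset G (sing_bundle P)"
proof -
  let ?S = "standard_simplex"
  have push: "sop (sing_bundle P) m n \<alpha> \<sigma> = (\<lambda>t\<in>?S m. \<sigma> (simplex_push m \<alpha> t))" for m n \<alpha> \<sigma>
    by (simp add: sing_bundle_def)
  have simps: "simps (sing_bundle P) n = singular_simplex_set n (tot P)" for n
    by (simp add: sing_bundle_def)
  have ract: "ract (sing_bundle P) n \<sigma> g = (\<lambda>t\<in>?S n. bact P (\<sigma> t) g)" for n \<sigma> g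
    by (simp add: sing_bundle_def)
  have id: "(\<lambda>t\<in>?S n. \<sigma> (simplex_push n (\<lambda>j\<in>{..n}. j) t)) = \<sigma>"
    if "\<sigma> \<in> singular_simplex_set n (tot P)" for n \<sigma>
    using singular_simplexD(2)[OF that]
    by (intro extensionalityI[of _ "?S n"]) (auto simp: simplex_push_id)
  have comp: "(\<lambda>t\<in>?S l. \<sigma> (simplex_push l (compose {..l} \<beta> \<alpha>) t)) =
      (\<lambda>t\<in>?S l. (\<lambda>t\<in>?S m. \<sigma> (simplex_push m \<beta> t)) (simplex_push l \<alpha> t))"
    if "\<alpha> \<in> ord_maps l m" for l m \<alpha> \<beta> and \<sigma> :: "(nat \<Rightarrow> real) \<Rightarrow> 'p"
    using that by (intro restrict_ext) (simp add: simplex_push_in simplex_push_comp)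
  have "is_sset (sing_bundle P)"
    unfolding is_sset_def push simps
    by (intro conjI allI ballI Pi_I; (rule singular_simplex_push | rule id | rule comp); assumption)
  moreover have "(\<lambda>t\<in>?S n. bact P (\<sigma> t) \<one>\<^bsub>G\<^esub>) = \<sigma>"
    if "\<sigma> \<in> singular_simplex_set n (tot P)" for n \<sigma>
    using singular_simplexD(2,3)[OF that]
    by (intro extensionalityI[of _ "?S n"]) (auto simp: one)
  moreover have "(\<lambda>t\<in>?S n. bact P ((\<lambda>t\<in>?S n. bact P (\<sigma> t) g) t) h) =
      (\<lambda>t\<in>?S n. bact P (\<sigma> t) (g \<otimes>\<^bsub>G\<^esub> h))"
    if "\<sigma> \<in> singular_simplex_set n (tot P)" "g \<in> carrier G" "h \<in> carrier G" for n \<sigma> g h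
    using singular_simplexD(3)[OF that(1)] that by (intro restrict_ext) (simp add: assoc)
  moreover have "(\<lambda>t\<in>?S m. (\<lambda>t\<in>?S n. bact P (\<sigma> t) g) (simplex_push m \<alpha> t)) =
      (\<lambda>t\<in>?S m. bact P ((\<lambda>t\<in>?S m. \<sigma> (simplex_push m \<alpha> t)) t) g)"
    if "\<alpha> \<in> ord_maps m n" for m n \<alpha> \<sigma> g
    using that by (intro restrict_ext) (simp add: simplex_push_in)
  ultimately show ?thesis
    unfolding is_gsset_def push simps ract using singular_simplex_map[OF _ cont] by simp
qed

section \<open>Pullback of bundles over spaces\<close>

lemma sing_pullback:
  assumes \<Phi>: "homeomorphic_map X Y \<Phi>" and P: "principal_bundle G Y P"
  shows "is_gsset G (sing_bundle P)"
    and "is_gsset G (sing_bundle (pullback_bundle X \<Phi> P))"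
    and "gsset_map G (sing_bundle (pullback_bundle X \<Phi> P)) (sing_bundle P) (sing_map snd)"
    and "bij_betw (sing_map snd n) (simps (sing_bundle (pullback_bundle X \<Phi> P)) n)
      (simps (sing_bundle P) n)"
proof -
  let ?E = "pullback_bundle X \<Phi> P"
  have proj: "continuous_map (tot P) Y (proj P)"
    and act: "\<And>g. g \<in> carrier G \<Longrightarrow> continuous_map (tot P) (tot P) (\<lambda>x. bact P x g)"
    and one: "\<And>x. x \<in> topspace (tot P) \<Longrightarrow> bact P x \<one>\<^bsub>G\<^esub> = x"
    and assoc: "\<And>x g h. x \<in> topspace (tot P) \<Longrightarrow> g \<in> carrier G \<Longrightarrow> h \<in> carrier G \<Longrightarrow>
      bact P (bact P x g) h = bact P x (g \<otimes>\<^bsub>G\<^esub> h)"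
    and proj_act: "\<And>x g. x \<in> topspace (tot P) \<Longrightarrow> g \<in> carrier G \<Longrightarrow> proj P (bact P x g) = proj P x"
    using P unfolding principal_bundle_def by blast+
  have tot: "tot ?E = subtopology (prod_topology X (tot P)) {(x, e). \<Phi> x = proj P e}"
    by (simp add: pullback_bundle_def)
  have top: "topspace (tot ?E) = {(x, e). x \<in> topspace X \<and> e \<in> topspace (tot P) \<and> \<Phi> x = proj P e}"
    by (auto simp: tot)
  have bact: "bact ?E p g = (fst p, bact P (snd p) g)" for p g
    by (simp add: pullback_bundle_def case_prod_beta)
  have fst: "continuous_map (tot ?E) X fst" and snd: "continuous_map (tot ?E) (tot P) snd"
    unfolding tot
    by (intro continuous_map_from_subtopology continuous_map_fst continuous_map_snd)+
  have act': "continuous_map (tot ?E) (tot ?E) (\<lambda>p. bact ?E p g)" if g: "g \<in> carrier G" for g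
  proof -
    have "continuous_map (tot ?E) (tot P) (\<lambda>p. bact P (snd p) g)"
      using continuous_map_compose[OF snd act[OF g]] by (simp add: comp_def)
    then have "continuous_map (tot ?E) (prod_topology X (tot P)) (\<lambda>p. bact ?E p g)"
      using fst by (simp add: bact continuous_map_pairedI)
    \<comment> \<open>The action preserves the fibres of P, hence also the equation cutting the
      pullback out of the product.\<close>
    moreover have "bact ?E p g \<in> {(x, e). \<Phi> x = proj P e}" if "p \<in> topspace (tot ?E)" for p
      using that g by (auto simp: top bact proj_act)
    ultimately show ?thesis
      unfolding tot by (subst continuous_map_in_subtopology) (auto simp: tot[symmetric])
  qed
  show "is_gsset G (sing_bundle P)"
    by (rule is_gsset_sing_bundle[OF act one assoc])
  show "is_gsset G (sing_bundle ?E)"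
    by (rule is_gsset_sing_bundle[OF act']) (auto simp: top bact one assoc)
  \<comment> \<open>General in the types of the bundle, since it is applied to both total
    spaces.\<close>
  have simps: "simps (sing_bundle B) n = singular_simplex_set n (tot B)" for n and B :: "('r, 'z, 'g) gbundle"
    by (simp add: sing_bundle_def)
  show "gsset_map G (sing_bundle ?E) (sing_bundle P) (sing_map snd)"
  proof -
    have "sing_map snd n \<sigma> \<in> simps (sing_bundle P) n" if "\<sigma> \<in> simps (sing_bundle ?E) n" for n \<sigma>
      using that singular_simplex_map[OF _ snd] by (simp add: simps sing_map_def)
    then show ?thesis
      by (auto simp: gsset_map_def simplicial_map_def sing_map_def sing_bundle_def bact
          simplex_push_in intro!: restrict_ext)
  qed
  obtain \<Psi> where \<Psi>: "homeomorphic_maps X Y \<Phi> \<Psi>"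
    using \<Phi> homeomorphic_map_maps by blast
  have cont\<Psi>: "continuous_map Y X \<Psi>" and \<Psi>\<Phi>: "\<And>x. x \<in> topspace X \<Longrightarrow> \<Psi> (\<Phi> x) = x"
    and \<Phi>\<Psi>: "\<And>y. y \<in> topspace Y \<Longrightarrow> \<Phi> (\<Psi> y) = y"
    using \<Psi> by (auto simp: homeomorphic_maps_def)
  \<comment> \<open>The inverse of the projection \<open>snd\<close>. It lands in the pullback
    because \<Phi> after \<Psi> is the identity; that it undoes \<open>snd\<close> uses the other
    composite. Composing singular simplices with it inverts \<open>sing_map snd\<close>.\<close>
  let ?s = "\<lambda>e. (\<Psi> (proj P e), e)"
  have lift: "continuous_map (tot P) (tot ?E) ?s"
  proof -
    have "continuous_map (tot P) X (\<lambda>e. \<Psi> (proj P e))"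
      using continuous_map_compose[OF proj cont\<Psi>] by (simp add: comp_def)
    then have "continuous_map (tot P) (prod_topology X (tot P)) ?s"
      by (simp add: continuous_map_pairedI)
    moreover have "proj P e \<in> topspace Y" if "e \<in> topspace (tot P)" for e
      using continuous_map_funspace[OF proj] that by blast
    ultimately show ?thesis
      unfolding tot by (auto simp: continuous_map_in_subtopology \<Phi>\<Psi>)
  qed
  have s_snd: "?s (snd p) = p" if "p \<in> topspace (tot ?E)" for p
  proof -
    obtain x e where p: "p = (x, e)" "x \<in> topspace X" "\<Phi> x = proj P e"
      using \<open>p \<in> topspace (tot ?E)\<close> top by auto
    then show ?thesis using \<Psi>\<Phi>[OF p(2)] by simp
  qed
  show "bij_betw (sing_map snd n) (simps (sing_bundle ?E) n) (simps (sing_bundle P) n)"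
    unfolding simps
  proof (rule bij_betw_byWitness[where f' = "sing_map ?s n"])
    show "\<forall>\<sigma>\<in>singular_simplex_set n (tot ?E). sing_map ?s n (sing_map snd n \<sigma>) = \<sigma>"
    proof
      fix \<sigma> assume \<sigma>: "\<sigma> \<in> singular_simplex_set n (tot ?E)"
      show "sing_map ?s n (sing_map snd n \<sigma>) = \<sigma>"
        using singular_simplexD(2,3)[OF \<sigma>] s_snd
        by (intro extensionalityI[of _ "standard_simplex n"]) (auto simp: sing_map_def)
    qed
    show "\<forall>\<sigma>\<in>singular_simplex_set n (tot P). sing_map snd n (sing_map ?s n \<sigma>) = \<sigma>"
    proof
      fix \<sigma> assume \<sigma>: "\<sigma> \<in> singular_simplex_set n (tot P)"
      show "sing_map snd n (sing_map ?s n \<sigma>) = \<sigma>"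
        using singular_simplexD(2)[OF \<sigma>]
        by (intro extensionalityI[of _ "standard_simplex n"]) (auto simp: sing_map_def)
    qed
    show "sing_map snd n ` singular_simplex_set n (tot ?E) \<subseteq> singular_simplex_set n (tot P)"
      using singular_simplex_map[OF _ snd] by (auto simp: sing_map_def)
    show "sing_map ?s n ` singular_simplex_set n (tot P) \<subseteq> singular_simplex_set n (tot ?E)"
      using singular_simplex_map[OF _ lift] by (auto simp: sing_map_def)
  qed
qed

section \<open>Pullback of bundles over simplicial sets\<close>

lemma pullback_sbundle_gsset:
  assumes X: "is_sset X" and \<Phi>: "\<Phi> \<in> sset_iso X Y"
    and P: "principal_sbundle G Y P \<pi>"
  shows "is_gsset G (pullback_sbundle X \<Phi> P \<pi>)"
    and "gsset_map G (pullback_sbundle X \<Phi> P \<pi>) P (\<lambda>_. snd)"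
    and "bij_betw snd (simps (pullback_sbundle X \<Phi> P \<pi>) n) (simps P n)"
proof -
  let ?E = "pullback_sbundle X \<Phi> P \<pi>"
  have P': "is_gsset G P" and \<pi>: "\<pi> \<in> sset_hom P Y"
    using P by (simp_all add: principal_sbundle_def)
  have \<Phi>_hom: "\<Phi> \<in> sset_hom X Y" using \<Phi> by (simp add: sset_iso_def)
  note PD = is_gssetD[OF P'] and \<pi>D = sset_homD[OF \<pi>] and \<Phi>D = sset_homD[OF \<Phi>_hom]
  have simps: "simps ?E n = {(x, e). x \<in> simps X n \<and> e \<in> simps P n \<and> \<Phi> n x = \<pi> n e}" for n
    by (simp add: pullback_sbundle_def)
  have sop: "sop ?E m n \<alpha> (x, e) = (sop X m n \<alpha> x, sop P m n \<alpha> e)" for m n \<alpha> x e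
    by (simp add: pullback_sbundle_def)
  have ract: "ract ?E n (x, e) g = (x, ract P n e g)" for n x e g
    by (simp add: pullback_sbundle_def)
  \<comment> \<open>Fibres of \<pi> are orbits, so \<pi> is invariant; the action on the second
    component therefore stays inside the pullback.\<close>
  have \<pi>_ract: "\<pi> n (ract P n e g) = \<pi> n e" if "e \<in> simps P n" "g \<in> carrier G" for n e g
    using P that PD(3)[OF that] unfolding principal_sbundle_def by metis
  have sop_in: "sop ?E m n \<alpha> p \<in> simps ?E m" if "\<alpha> \<in> ord_maps m n" "p \<in> simps ?E n" for m n \<alpha> p
    using that is_sset_sop_closed[OF X that(1)] is_sset_sop_closed[OF PD(1) that(1)]
      \<pi>D(2)[OF that(1)] \<Phi>D(2)[OF that(1)] by (auto simp: simps sop)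
  have "sop ?E l n (compose {..l} \<beta> \<alpha>) p = sop ?E l m \<alpha> (sop ?E m n \<beta> p)"
    if "\<alpha> \<in> ord_maps l m" "\<beta> \<in> ord_maps m n" and p_in: "p \<in> simps ?E n" for l m n \<alpha> \<beta> p
  proof -
    obtain x e where p: "p = (x, e)" "x \<in> simps X n" "e \<in> simps P n" using p_in simps by auto
    have "sop X l n (compose {..l} \<beta> \<alpha>) x = sop X l m \<alpha> (sop X m n \<beta> x)"
      using X that(1,2) p(2) unfolding is_sset_def by blast
    moreover have "sop P l n (compose {..l} \<beta> \<alpha>) e = sop P l m \<alpha> (sop P m n \<beta> e)"
      using PD(1) that(1,2) p(3) unfolding is_sset_def by blast
    ultimately show ?thesis by (simp add: p(1) sop)
  qed
  moreover have "sop ?E n n (\<lambda>j\<in>{..n}. j) p = p" if p_in: "p \<in> simps ?E n" for n p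
  proof -
    obtain x e where p: "p = (x, e)" "x \<in> simps X n" "e \<in> simps P n" using p_in simps by auto
    have "sop X n n (\<lambda>j\<in>{..n}. j) x = x" using X p(2) unfolding is_sset_def by blast
    moreover have "sop P n n (\<lambda>j\<in>{..n}. j) e = e" using PD(1) p(3) unfolding is_sset_def by blast
    ultimately show ?thesis by (simp add: p(1) sop)
  qed
  ultimately have "is_sset ?E"
    unfolding is_sset_def using sop_in by blast
  moreover have "ract P n (ract P n e g) h = ract P n e (g \<otimes>\<^bsub>G\<^esub> h)"
    if "e \<in> simps P n" "g \<in> carrier G" "h \<in> carrier G" for n e g h
    using P' that unfolding is_gsset_def by blast
  ultimately show "is_gsset G ?E"
    unfolding is_gsset_def using PD(2-4) \<pi>_ract by (auto simp: simps sop ract)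
  show "gsset_map G ?E P (\<lambda>_. snd)"
    by (auto simp: gsset_map_def simplicial_map_def simps sop ract)
  obtain \<Psi> where \<Psi>: "\<Psi> \<in> sset_hom Y X"
    and "sset_comp X \<Psi> \<Phi> = sset_id X" and "sset_comp Y \<Phi> \<Psi> = sset_id Y"
    using \<Phi> by (auto simp: sset_iso_def)
  then have "compose (simps X n) (\<Psi> n) (\<Phi> n) = (\<lambda>x\<in>simps X n. x)"
    and "compose (simps Y n) (\<Phi> n) (\<Psi> n) = (\<lambda>y\<in>simps Y n. y)"
    unfolding sset_comp_def sset_id_def by (auto dest!: fun_cong[of _ _ n])
  then have \<Psi>\<Phi>: "\<And>x. x \<in> simps X n \<Longrightarrow> \<Psi> n (\<Phi> n x) = x"
    and \<Phi>\<Psi>: "\<And>y. y \<in> simps Y n \<Longrightarrow> \<Phi> n (\<Psi> n y) = y"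
    by (metis compose_eq restrict_apply')+
  show "bij_betw snd (simps ?E n) (simps P n)"
  \<comment> \<open>As for spaces, the first component is recovered from \<open>e\<close> as the
    preimage under \<Phi> of its base point.\<close>
  proof (rule bij_betw_byWitness[where f' = "\<lambda>e. (\<Psi> n (\<pi> n e), e)"])
    show "\<forall>p\<in>simps ?E n. (\<Psi> n (\<pi> n (snd p)), snd p) = p"
    proof
      fix p assume "p \<in> simps ?E n"
      then obtain x e where p: "p = (x, e)" "x \<in> simps X n" "\<Phi> n x = \<pi> n e"
        using simps by auto
      then show "(\<Psi> n (\<pi> n (snd p)), snd p) = p" using \<Psi>\<Phi>[OF p(2)] by simp
    qed
    show "(\<lambda>e. (\<Psi> n (\<pi> n e), e)) ` simps P n \<subseteq> simps ?E n"
      using \<Phi>\<Psi> \<pi>D(1) sset_homD(1)[OF \<Psi>] by (auto simp: simps)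
  qed (auto simp: simps)
qed

theorem proposition2p16:
  fixes k :: "'k ring" and Op :: "('k, 'o) operad" and G :: "'g monoid"
    and std :: "(nat \<Rightarrow> nat) \<Rightarrow> 's"
    and T :: "('k, 'o, 'v, 's) tensoring" and Q :: "('k, 'o, 'v) replacement"
    and A :: "('k, 'o, 'v) alg" and \<rho> :: "'g \<Rightarrow> 'v \<Rightarrow> 'v"
    and X :: "'x topology" and Y :: "'y topology" and \<Phi> :: "'x \<Rightarrow> 'y"
    and P :: "('p, 'y, 'g) gbundle"
    and c\<^sub>0 :: "((nat \<Rightarrow> real) \<Rightarrow> 'p) \<times> 'g list \<Rightarrow> 's"
    and c\<^sub>1 :: "((nat \<Rightarrow> real) \<Rightarrow> 'x \<times> 'p) \<times> 'g list \<Rightarrow> 's"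
    and X' :: "'xs sset" and Y' :: "'ys sset" and \<Phi>' :: "nat \<Rightarrow> 'xs \<Rightarrow> 'ys"
    and P' :: "('q, 'g) gsset" and \<pi>' :: "nat \<Rightarrow> 'q \<Rightarrow> 'ys"
    and d\<^sub>0 :: "'q \<times> 'g list \<Rightarrow> 's" and d\<^sub>1 :: "('xs \<times> 'q) \<times> 'g list \<Rightarrow> 's"
    and R\<^sub>0 R\<^sub>1 :: "('k, 'o, 'v) alg" and \<iota>\<^sub>0 \<iota>\<^sub>1 :: "nat \<Rightarrow> 'v \<Rightarrow> 'v"
  assumes "field k" and "einf_operad k Op"
    and "inj std" and "is_tensoring k Op std T" and "tensoring_SM7 k Op std T"
    and "cofibrant_replacement k Op Q"
    and "group G" and "equivariant_alg k Op G A \<rho>"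
  shows
    "(homeomorphic_map X Y \<Phi> \<and> principal_bundle G Y P \<and> inj c\<^sub>0 \<and> inj c\<^sub>1 \<and>
      hochschild_chains k Op std T Q c\<^sub>1 G (sing_bundle (pullback_bundle X \<Phi> P)) A \<rho> R\<^sub>1 \<iota>\<^sub>1 \<and>
      hochschild_chains k Op std T Q c\<^sub>0 G (sing_bundle P) A \<rho> R\<^sub>0 \<iota>\<^sub>0
      \<longrightarrow> (\<exists>f\<in>alg_iso k Op R\<^sub>1 R\<^sub>0.
            hochschild_map std T Q c\<^sub>1 c\<^sub>0 G (sing_bundle (pullback_bundle X \<Phi> P)) (sing_bundle P) A
              (sing_map snd) \<iota>\<^sub>1 \<iota>\<^sub>0 f)) \<and>
     (is_sset X' \<and> is_sset Y' \<and> \<Phi>' \<in> sset_iso X' Y' \<and> principal_sbundle G Y' P' \<pi>' \<and>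
      inj d\<^sub>0 \<and> inj d\<^sub>1 \<and>
      hochschild_chains k Op std T Q d\<^sub>1 G (pullback_sbundle X' \<Phi>' P' \<pi>') A \<rho> R\<^sub>1 \<iota>\<^sub>1 \<and>
      hochschild_chains k Op std T Q d\<^sub>0 G P' A \<rho> R\<^sub>0 \<iota>\<^sub>0
      \<longrightarrow> (\<exists>f\<in>alg_iso k Op R\<^sub>1 R\<^sub>0.
            hochschild_map std T Q d\<^sub>1 d\<^sub>0 G (pullback_sbundle X' \<Phi>' P' \<pi>') P' A
              (\<lambda>_. snd) \<iota>\<^sub>1 \<iota>\<^sub>0 f))"
proof -
  interpret hochschild k Op std T Q G A \<rho>
    by (intro hochschild.intro algebra_tensoring.intro hochschild_axioms.intro) (fact assms)+
  have top: "\<exists>f\<in>alg_iso k Op R\<^sub>1 R\<^sub>0.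
      hochschild_map std T Q c\<^sub>1 c\<^sub>0 G (sing_bundle (pullback_bundle X \<Phi> P)) (sing_bundle P) A
        (sing_map snd) \<iota>\<^sub>1 \<iota>\<^sub>0 f"
    if \<Phi>: "homeomorphic_map X Y \<Phi>" and P: "principal_bundle G Y P" and c: "inj c\<^sub>0" "inj c\<^sub>1"
      and R\<^sub>1: "hochschild_chains k Op std T Q c\<^sub>1 G (sing_bundle (pullback_bundle X \<Phi> P)) A \<rho> R\<^sub>1 \<iota>\<^sub>1"
      and R\<^sub>0: "hochschild_chains k Op std T Q c\<^sub>0 G (sing_bundle P) A \<rho> R\<^sub>0 \<iota>\<^sub>0"
    \<comment> \<open>The comparison map runs from the pullback to P, so the encoding
      \<open>c\<^sub>1\<close> of its source comes first.\<close>
    using sing_pullback[OF \<Phi> P] by (intro hochschild_chains_iso[OF c(2,1) _ _ _ _ R\<^sub>1 R\<^sub>0])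
  have simplicial: "\<exists>f\<in>alg_iso k Op R\<^sub>1 R\<^sub>0.
      hochschild_map std T Q d\<^sub>1 d\<^sub>0 G (pullback_sbundle X' \<Phi>' P' \<pi>') P' A (\<lambda>_. snd) \<iota>\<^sub>1 \<iota>\<^sub>0 f"
    if X': "is_sset X'" and \<Phi>': "\<Phi>' \<in> sset_iso X' Y'" and P': "principal_sbundle G Y' P' \<pi>'"
      and d: "inj d\<^sub>0" "inj d\<^sub>1"
      and R\<^sub>1: "hochschild_chains k Op std T Q d\<^sub>1 G (pullback_sbundle X' \<Phi>' P' \<pi>') A \<rho> R\<^sub>1 \<iota>\<^sub>1"
      and R\<^sub>0: "hochschild_chains k Op std T Q d\<^sub>0 G P' A \<rho> R\<^sub>0 \<iota>\<^sub>0"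
    using pullback_sbundle_gsset[OF X' \<Phi>' P'] P'
    by (intro hochschild_chains_iso[OF d(2,1) _ _ _ _ R\<^sub>1 R\<^sub>0]) (simp_all add: principal_sbundle_def)
  show ?thesis using top simplicial by blast
qed

end
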